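(* Let $p\geq 2$ and let $Y=\theta+\xi$, where $\theta\in\mathbb{R}^p$ is a constant (unknown) vector and $\xi$ is a random vector which, conditionally on a fixed $\sigma$-algebra $\mathcal{G}$, is Gaussian: $\mathrm{Law}(\xi\mid\mathcal{G})=\mathcal{N}_p(0,\mathcal{D}(\mathcal{G}))$, with $\mathcal{D}(\mathcal{G})$ a $\mathcal{G}$-measurable random positive definite $p\times p$ covariance matrix. Let $\Theta\subset\mathbb{R}^p$ be a compact set and assume: (i) there is a constant $\lambda_*>0$ such that $\lambda_{\min}(\mathcal{D}(\mathcal{G}))\geq\lambda_*$ almost surely; (ii) $\sup_{\theta\in\Theta}\mathbf{E}_\theta\,\lambda_{\max}(\mathcal{D}(\mathcal{G}))\leq a^*$ for some known constant $a^*>0$. Let $\gamma_p$ be the constant defined in the context, and consider the estimator $\theta^*=\left(1-\frac{c}{\|Y\|}\right)Y$ with $c=(p-1)\lambda_*\gamma_p$. Then $\theta^*$ dominates the maximum likelihood estimator $\hat\theta_{ML}=Y$ on $\Theta$, namely $$\sup_{\theta\in\Theta}\Delta(\theta)\leq-\big[(p-1)\lambda_*\gamma_p\big]^2,\qquad \Delta(\theta):=\mathbf{E}_\theta\|\theta^*-\theta\|^2-\mathbf{E}_\theta\|\hat\theta_{ML}-\theta\|^2 .$$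
   Context: $\mathbf{E}_\theta$ denotes expectation when the true parameter is $\theta$; $\lambda_{\min}(A),\lambda_{\max}(A)$ are the smallest and largest eigenvalues of a symmetric matrix $A$. Set $d=\sup\{\|\theta\|:\theta\in\Theta\}$ (the definition below requires $d>0$), $\mu=d/\sqrt{a^*}$, $I(a)=\int_0^\infty\frac{e^{-r^2/2}}{a+r}\,dr$, and $$\gamma_p=\frac{\sum_{j=0}^{p-2}2^{\frac{j-1}{2}}(-1)^{p-j}\mu^{p-1-j}\Gamma\!\left(\frac{j+1}{2}\right)-(-\mu)^pI(\mu)}{2^{p/2-1}\Gamma\!\left(\frac p2\right)d}.$$ *)

theory Defs
  imports "HOL-Probability.Probability"
begin

definition pos_def_mat :: "real^'n^'n \<Rightarrow> bool" where
  "pos_def_mat S \<longleftrightarrow> transpose S = S \<and> (\<forall>x. x \<noteq> 0 \<longrightarrow> x \<bullet> (S *v x) > 0)"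

definition real_eigenvalues :: "real^'n^'n \<Rightarrow> real set" where
  "real_eigenvalues S = {c. \<exists>v. v \<noteq> 0 \<and> S *v v = c *\<^sub>R v}"

definition lambda_min :: "real^'n^'n \<Rightarrow> real" where
  "lambda_min S = Min (real_eigenvalues S)"

definition lambda_max :: "real^'n^'n \<Rightarrow> real" where
  "lambda_max S = Max (real_eigenvalues S)"

definition mvn_density :: "real^'n^'n \<Rightarrow> real^'n \<Rightarrow> real" where
  "mvn_density S x =
     exp (- (x \<bullet> (matrix_inv S *v x)) / 2) / sqrt ((2 * pi) ^ CARD('n) * det S)"

definition normal_vec :: "real^'n^'n \<Rightarrow> (real^'n) measure" where
  "normal_vec S = density lborel (\<lambda>x. ennreal (mvn_density S x))"

definition I_fun :: "real \<Rightarrow> real" where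
  "I_fun a = integral {0..} (\<lambda>r. exp (- (r\<^sup>2) / 2) / (a + r))"

text \<open>The constant gamma_p, with d = sup of norms over Theta and mu = d / sqrt a*.\<close>
definition gamma_const :: "nat \<Rightarrow> real \<Rightarrow> real \<Rightarrow> real" where
  "gamma_const p d astar =
     (let \<mu> = d / sqrt astar in
      ((\<Sum>j = 0..p - 2. 2 powr ((real j - 1) / 2) * (-1) ^ (p - j) * \<mu> ^ (p - 1 - j)
                          * Gamma ((real j + 1) / 2))
        - (- \<mu>) ^ p * I_fun \<mu>)
      / (2 powr (real p / 2 - 1) * Gamma (real p / 2) * d))"

end

theory Submission
  imports Defs
begin

text \<open>
  Write \<open>Y = \<theta> + \<xi>\<close>. Expanding the square, the risk difference is at most \<open>c\<^sup>2 - 2 * c * E (\<xi> \<bullet> sgn Y)\<close>, so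
  it suffices that the mean radial component \<open>E (\<xi> \<bullet> sgn Y)\<close> of the noise is at least \<open>c\<close>. For a fixed
  covariance \<open>S\<close>, Stein's identity for the vector field \<open>sgn\<close> (smoothed near \<open>0\<close>) and
  \<open>trace S - u \<bullet> (S *v u) \<ge> (p - 1) * lambda_min S\<close> for unit vectors \<open>u\<close> give
  \<open>E (\<xi> \<bullet> sgn Y) \<ge> (p - 1) * lambda_min S * E (1 / (d + norm \<xi>))\<close>. As \<open>\<xi>\<close> is distributed like \<open>A *v \<eta>\<close>
  with \<open>\<eta>\<close> standard normal and \<open>norm (A *v \<eta>) \<le> sqrt (lambda_max S) * norm \<eta>\<close>, the last expectation is at
  least \<open>E (1 / (d + sqrt (lambda_max S) * norm \<eta>))\<close>, which polar coordinates identify as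
  \<open>gamma_const p d (lambda_max S)\<close>. Since \<open>gamma_const p d\<close> is convex and decreasing, Jensen's inequality
  replaces the random \<open>lambda_max S\<close> by the bound \<open>astar\<close> on its mean.
\<close>

subsection \<open>Symmetric matrices\<close>

lemma selfadjoint_rayleigh_minimizer_eigenvector:
  fixes f :: "'a::real_inner \<Rightarrow> 'a"
  assumes f: "linear f" and sa: "\<And>x y. f x \<bullet> y = x \<bullet> f y"
    and V: "subspace V" "f ` V \<subseteq> V" and u: "u \<in> V" "norm u = 1"
    and min: "\<And>x. x \<in> V \<Longrightarrow> (u \<bullet> f u) * (x \<bullet> x) \<le> x \<bullet> f x"
  shows "f u = (u \<bullet> f u) *\<^sub>R u"
proof -
  define m where "m = u \<bullet> f u"
  define w where "w = f u - m *\<^sub>R u"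
  define g where "g = w \<bullet> f w - m * (w \<bullet> w)"
  have uu: "u \<bullet> u = 1" using u(2) by (simp add: dot_square_norm)
  have w: "w \<in> V" unfolding w_def using V u by (auto intro!: subspace_diff subspace_scale)
  have excess: "2 * t * (w \<bullet> w) + t\<^sup>2 * g \<ge> 0" for t
  proof -
    have "u + t *\<^sub>R w \<in> V" using V u w by (intro subspace_add subspace_scale)
    from min[OF this] have "0 \<le> (u + t *\<^sub>R w) \<bullet> f (u + t *\<^sub>R w) - m * ((u + t *\<^sub>R w) \<bullet> (u + t *\<^sub>R w))"
      by (simp add: m_def)
    also have "\<dots> = u \<bullet> f u - m + 2 * t * (w \<bullet> f u - m * (w \<bullet> u)) + t\<^sup>2 * g"
      by (simp add: linear_add[OF f] linear_scale[OF f] inner_add inner_commute[of u w] uu g_def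
          algebra_simps power2_eq_square sa[symmetric] inner_commute[of "f u" w])
    also have "\<dots> = 2 * t * (w \<bullet> w) + t\<^sup>2 * g"
      by (simp add: m_def[symmetric] w_def inner_diff inner_commute algebra_simps uu)
    finally show ?thesis .
  qed
  have "((\<lambda>t. 2 * t * (w \<bullet> w) + t\<^sup>2 * g) has_real_derivative 2 * (w \<bullet> w)) (at 0)"
    by (auto intro!: derivative_eq_intros)
  then have "2 * (w \<bullet> w) = 0"
    by (rule DERIV_local_min[where d = 1]) (use excess in auto)
  then show ?thesis by (simp add: w_def m_def)
qed

lemma selfadjoint_obtains_unit_eigenvector:
  fixes f :: "'a::euclidean_space \<Rightarrow> 'a"
  assumes f: "linear f" and sa: "\<And>x y. f x \<bullet> y = x \<bullet> f y"
    and V: "subspace V" "f ` V \<subseteq> V" "V \<noteq> {0}"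
  obtains u c where "u \<in> V" "norm u = 1" "f u = c *\<^sub>R u"
proof -
  let ?K = "V \<inter> sphere 0 1"
  obtain v where v: "v \<in> V" "v \<noteq> 0" using V subspace_0 by blast
  have "compact ?K" by (simp add: V(1) closed_subspace closed_Int_compact)
  moreover have "v /\<^sub>R norm v \<in> ?K" using v V(1) by (simp add: subspace_scale)
  moreover have "continuous_on ?K (\<lambda>x. x \<bullet> f x)"
    using f by (intro continuous_intros linear_continuous_on linear_conv_bounded_linear[THEN iffD1])
  ultimately obtain u where "u \<in> ?K" and min: "\<And>x. x \<in> ?K \<Longrightarrow> u \<bullet> f u \<le> x \<bullet> f x"
    using continuous_attains_inf[of ?K "\<lambda>x. x \<bullet> f x"] by blast
  then have u: "u \<in> V" "norm u = 1" by auto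
  have "(u \<bullet> f u) * (x \<bullet> x) \<le> x \<bullet> f x" if "x \<in> V" for x
  proof (cases "x = 0")
    case False
    have "x /\<^sub>R norm x \<in> ?K" using that False V(1) by (simp add: subspace_scale)
    from min[OF this] have "u \<bullet> f u \<le> (x \<bullet> f x) / (norm x * norm x)"
      by (simp add: linear_scale[OF f] field_simps)
    then show ?thesis using False by (simp add: field_simps dot_square_norm power2_eq_square)
  qed (simp add: linear_0[OF f])
  then have "f u = (u \<bullet> f u) *\<^sub>R u"
    by (rule selfadjoint_rayleigh_minimizer_eigenvector[OF f sa V(1,2) u])
  with u show ?thesis by (rule that)
qed

lemma span_insert_unit_vector_orthogonal_complement:
  fixes u :: "'a::real_inner"
  assumes V: "subspace V" and u: "u \<in> V" "norm u = 1" and B: "span B = {x \<in> V. u \<bullet> x = 0}"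
  shows "span (insert u B) = V"
proof
  show "span (insert u B) \<subseteq> V"
    using u V span_superset[of B] B by (intro span_minimal) auto
  show "V \<subseteq> span (insert u B)"
  proof
    fix x assume "x \<in> V"
    then have "x - (u \<bullet> x) *\<^sub>R u \<in> span B"
      using V u
      by (auto simp: B inner_diff_right dot_square_norm intro!: subspace_diff subspace_scale)
    then show "x \<in> span (insert u B)" by (auto simp: span_insert)
  qed
qed

lemma selfadjoint_orthonormal_eigenbasis:
  fixes f :: "'a::euclidean_space \<Rightarrow> 'a"
  assumes f: "linear f" and sa: "\<And>x y. f x \<bullet> y = x \<bullet> f y"
    and "subspace V" "f ` V \<subseteq> V"
  shows "\<exists>B. B \<subseteq> V \<and> pairwise orthogonal B \<and> (\<forall>b\<in>B. norm b = 1 \<and> (\<exists>c. f b = c *\<^sub>R b)) \<and> span B = V"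
  using assms(3,4)
proof (induction "dim V" arbitrary: V rule: less_induct)
  case less
  note V = less.prems
  show ?case
  proof (cases "V = {0}")
    case True
    then show ?thesis by (intro exI[of _ "{}"]) auto
  next
    case False
    obtain u c where u: "u \<in> V" "norm u = 1" "f u = c *\<^sub>R u"
      by (rule selfadjoint_obtains_unit_eigenvector[OF f sa V False])
    have uu: "u \<bullet> u = 1" using u(2) by (simp add: dot_square_norm)
    define W where "W = {x \<in> V. u \<bullet> x = 0}"
    have W: "subspace W" using V(1) unfolding W_def subspace_def by (auto simp: inner_add_right)
    moreover have "f ` W \<subseteq> W" using V(2) by (auto simp: W_def sa[symmetric] u(3))
    moreover have "dim W < dim V"
    proof (rule dim_psubset)
      have "u \<notin> W" using uu by (simp add: W_def)
      moreover have "W \<subseteq> V" by (auto simp: W_def)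
      ultimately have "W \<subset> V" using u(1) by blast
      then show "span W \<subset> span V" by (simp add: span_eq_iff[THEN iffD2] V(1) W)
    qed
    ultimately obtain B where B: "B \<subseteq> W" "pairwise orthogonal B"
      "\<forall>b\<in>B. norm b = 1 \<and> (\<exists>c. f b = c *\<^sub>R b)" "span B = W"
      using less.hyps by blast
    have "span (insert u B) = V"
      using B(4) by (intro span_insert_unit_vector_orthogonal_complement V(1) u) (simp add: W_def)
    moreover have "pairwise orthogonal (insert u B)"
      using B(1,2) by (auto simp: pairwise_insert orthogonal_def W_def inner_commute)
    ultimately show ?thesis
      using B u by (intro exI[of _ "insert u B"]) (auto simp: W_def)
  qed
qed

lemma symmetric_matrix_selfadjoint:
  fixes S :: "real^'n^'n"
  assumes "transpose S = S"
  shows "(S *v x) \<bullet> y = x \<bullet> (S *v y)"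
  using assms by (metis dot_lmul_matrix vector_transpose_matrix)

definition diag_mat :: "('n \<Rightarrow> real) \<Rightarrow> real^'n^'n" where
  "diag_mat l = (\<chi> i j. if i = j then l i else 0)"

lemma diag_mat_mult_vec: "diag_mat l *v x = (\<chi> i. l i * x $ i)"
  by (simp add: diag_mat_def matrix_vector_mult_def vec_eq_iff if_distrib[of "\<lambda>a. a * _"] cong: if_cong)

lemma diag_mat_mult_diag_mat: "diag_mat l ** diag_mat k = diag_mat (\<lambda>i. l i * k i)"
  by (simp add: matrix_eq matrix_vector_mul_assoc[symmetric] diag_mat_mult_vec vec_eq_iff mult.assoc)

lemma diag_mat_1: "diag_mat (\<lambda>_. 1) = mat 1"
  by (simp add: diag_mat_def mat_def)

lemma transpose_diag_mat: "transpose (diag_mat l) = diag_mat l"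
  by (auto simp: diag_mat_def transpose_def vec_eq_iff)

lemma det_diag_mat: "det (diag_mat l) = (\<Prod>i\<in>UNIV. l i)"
  by (subst det_diagonal) (simp_all add: diag_mat_def)

lemma trace_diag_mat: "trace (diag_mat l) = (\<Sum>i\<in>UNIV. l i)"
  by (simp add: diag_mat_def trace_def)

definition spectral_decomposition :: "real^'n^'n \<Rightarrow> real^'n^'n \<Rightarrow> ('n \<Rightarrow> real) \<Rightarrow> bool" where
  "spectral_decomposition S Q l \<longleftrightarrow> orthogonal_matrix Q \<and> S = Q ** diag_mat l ** transpose Q"

lemma spectral_decompositionI:
  assumes Q: "orthogonal_matrix Q" and "S ** Q = Q ** diag_mat l"
  shows "spectral_decomposition S Q l"
  using assms
  by (metis matrix_mul_assoc matrix_mul_rid orthogonal_matrix_def spectral_decomposition_def)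

lemma symmetric_matrix_spectral:
  fixes S :: "real^'n^'n"
  assumes "transpose S = S"
  obtains Q l where "spectral_decomposition S Q l"
proof -
  obtain B where B: "pairwise orthogonal B" "\<forall>b\<in>B. norm b = 1 \<and> (\<exists>c. S *v b = c *\<^sub>R b)"
    "span B = (UNIV :: (real^'n) set)"
    using selfadjoint_orthonormal_eigenbasis[of "(*v) S" UNIV] symmetric_matrix_selfadjoint[OF assms]
    by auto
  have ind: "independent B" using B(1,2) by (intro pairwise_orthogonal_independent) auto
  have "card B = CARD('n)"
    using dim_eq_card_independent[OF ind] dim_span[of B] B(3) by simp
  then obtain q where q: "bij_betw q (UNIV :: 'n set) B"
    using ind by (metis finite_class.finite_UNIV finite_same_card_bij finiteI_independent)
  have "\<forall>i. \<exists>c. S *v q i = c *\<^sub>R q i" using B(2) bij_betwE[OF q] by blast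
  then obtain l where l: "\<And>i. S *v q i = l i *\<^sub>R q i" by metis
  define Q :: "real^'n^'n" where "Q = (\<chi> i j. q j $ i)"
  have col: "column i Q = q i" for i by (simp add: Q_def column_def)
  have "norm (q i) = 1" for i using B(2) bij_betwE[OF q] by blast
  moreover have "orthogonal (q i) (q j)" if "i \<noteq> j" for i j
    using B(1) bij_betwE[OF q] bij_betw_imp_inj_on[OF q] that by (simp add: pairwise_def inj_eq)
  ultimately have "orthogonal_matrix Q"
    by (simp add: orthogonal_matrix_orthonormal_columns col)
  moreover have "S ** Q = Q ** diag_mat l"
  proof (intro vec_eq_iff[THEN iffD2] allI)
    fix i j
    have "(S ** Q) $ i $ j = (S *v q j) $ i"
      by (simp add: Q_def matrix_matrix_mult_def matrix_vector_mult_def)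
    also have "\<dots> = q j $ i * l j" by (simp add: l)
    also have "\<dots> = (Q ** diag_mat l) $ i $ j"
      by (simp add: Q_def diag_mat_def matrix_matrix_mult_def if_distrib[of "\<lambda>a. _ * a"] cong: if_cong)
    finally show "(S ** Q) $ i $ j = (Q ** diag_mat l) $ i $ j" .
  qed
  ultimately show ?thesis by (rule that[OF spectral_decompositionI])
qed

lemma orthogonal_matrix_cancel:
  fixes Q :: "real^'n^'n"
  assumes "orthogonal_matrix Q"
  shows "Q *v (x v* Q) = x" "(Q *v x) v* Q = x"
  using assms unfolding transpose_matrix_vector[symmetric]
  by (simp_all add: orthogonal_matrix_def matrix_vector_mul_assoc del: transpose_matrix_vector)

lemma norm_orthogonal_matrix_mult:
  fixes Q :: "real^'n^'n"
  assumes "orthogonal_matrix Q"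
  shows "norm (Q *v x) = norm x" "norm (x v* Q) = norm x"
proof -
  show *: "norm (Q *v x) = norm x" for x
    using assms orthogonal_transformation_norm[of "(*v) Q"]
    by (simp add: orthogonal_transformation_matrix)
  show "norm (x v* Q) = norm x"
    using *[of "x v* Q"] by (simp add: orthogonal_matrix_cancel[OF assms])
qed

context
  fixes S Q :: "real^'n^'n" and l :: "'n \<Rightarrow> real"
  assumes S: "spectral_decomposition S Q l"
begin

lemma spectral_orthogonal: "orthogonal_matrix Q"
  using S by (simp add: spectral_decomposition_def)

lemma spectral_mult_vec: "S *v x = Q *v (diag_mat l *v (x v* Q))"
proof -
  have "S *v x = Q *v (diag_mat l *v (transpose Q *v x))"
    using S by (simp only: spectral_decomposition_def matrix_vector_mul_assoc matrix_mul_assoc)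
  then show ?thesis by simp
qed

lemma spectral_eigenvector: "S *v (Q *v axis i 1) = l i *\<^sub>R (Q *v axis i 1)"
proof -
  have "diag_mat l *v axis i 1 = l i *\<^sub>R axis i 1"
    by (auto simp: diag_mat_mult_vec vec_eq_iff axis_def)
  then show ?thesis
    by (simp add: spectral_mult_vec orthogonal_matrix_cancel[OF spectral_orthogonal]
        matrix_vector_mult_scaleR)
qed

lemma spectral_eigenvector_nonzero: "Q *v axis i 1 \<noteq> 0"
  using norm_orthogonal_matrix_mult(1)[OF spectral_orthogonal, of "axis i 1"] by auto

lemma spectral_real_eigenvalues: "real_eigenvalues S = range l"
proof (intro equalityI subsetI)
  fix c assume "c \<in> real_eigenvalues S"
  then obtain v where v: "v \<noteq> 0" "S *v v = c *\<^sub>R v" by (auto simp: real_eigenvalues_def)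
  have "v v* Q \<noteq> 0" using v(1) norm_orthogonal_matrix_mult(2)[OF spectral_orthogonal, of v] by auto
  then obtain i where i: "(v v* Q) $ i \<noteq> 0" by (auto simp: vec_eq_iff)
  have "diag_mat l *v (v v* Q) = (S *v v) v* Q"
    by (simp add: spectral_mult_vec orthogonal_matrix_cancel[OF spectral_orthogonal])
  also have "\<dots> = c *\<^sub>R (v v* Q)" by (simp add: v(2) scaleR_vector_matrix_assoc)
  finally have "l i * (v v* Q) $ i = c * (v v* Q) $ i" by (simp add: diag_mat_mult_vec vec_eq_iff)
  with i show "c \<in> range l" by auto
next
  fix c assume "c \<in> range l"
  then show "c \<in> real_eigenvalues S"
    using spectral_eigenvector spectral_eigenvector_nonzero by (auto simp: real_eigenvalues_def)
qed

lemma spectral_ge_lambda_min: "lambda_min S \<le> l i"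
  and spectral_le_lambda_max: "l i \<le> lambda_max S"
  by (simp_all add: lambda_min_def lambda_max_def spectral_real_eigenvalues)

lemma spectral_quadratic_form: "x \<bullet> (S *v x) = (\<Sum>i\<in>UNIV. l i * ((x v* Q) $ i)\<^sup>2)"
proof -
  have "x \<bullet> (S *v x) = (x v* Q) \<bullet> (diag_mat l *v (x v* Q))"
    by (simp add: spectral_mult_vec dot_lmul_matrix)
  then show ?thesis by (simp add: inner_vec_def diag_mat_mult_vec power2_eq_square mult_ac)
qed

lemma spectral_inner_self: "x \<bullet> x = (\<Sum>i\<in>UNIV. ((x v* Q) $ i)\<^sup>2)"
proof -
  have "x \<bullet> x = (x v* Q) \<bullet> (x v* Q)"
    by (simp add: dot_square_norm norm_orthogonal_matrix_mult(2)[OF spectral_orthogonal])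
  then show ?thesis by (simp add: inner_vec_def power2_eq_square)
qed

lemma spectral_trace: "trace S = (\<Sum>i\<in>UNIV. l i)"
proof -
  have "trace S = trace (transpose Q ** (Q ** diag_mat l))"
    using S by (simp add: spectral_decomposition_def trace_mul_sym[of "transpose Q"])
  also have "\<dots> = trace (diag_mat l)"
    using spectral_orthogonal by (simp add: matrix_mul_assoc orthogonal_matrix_def)
  finally show ?thesis by (simp add: trace_diag_mat)
qed

lemma spectral_pos:
  assumes "pos_def_mat S" shows "0 < l i"
proof -
  let ?v = "Q *v axis i 1"
  have "0 < ?v \<bullet> (S *v ?v)"
    using assms spectral_eigenvector_nonzero by (simp add: pos_def_mat_def)
  then show ?thesis
    by (simp add: spectral_eigenvector zero_less_mult_iff not_less[THEN iffD2, OF inner_ge_zero])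
qed

end

lemma pos_def_mat_symmetric: "pos_def_mat S \<Longrightarrow> transpose S = S"
  by (simp add: pos_def_mat_def)

lemma lambda_min_pos:
  assumes "pos_def_mat S" shows "0 < lambda_min S"
proof -
  obtain Q l where Q: "spectral_decomposition S Q l"
    by (rule symmetric_matrix_spectral[OF pos_def_mat_symmetric[OF assms]])
  have "lambda_min S \<in> range l"
    by (simp add: lambda_min_def spectral_real_eigenvalues[OF Q] Min_in)
  then show ?thesis using spectral_pos[OF Q assms] by auto
qed

lemma rayleigh_le_lambda_max:
  assumes "transpose S = S"
  shows "x \<bullet> (S *v x) \<le> lambda_max S * (x \<bullet> x)"
proof -
  obtain Q l where Q: "spectral_decomposition S Q l"
    by (rule symmetric_matrix_spectral[OF assms])
  show ?thesis
    unfolding spectral_quadratic_form[OF Q] spectral_inner_self[OF Q] sum_distrib_left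
    by (intro sum_mono mult_right_mono spectral_le_lambda_max[OF Q]) simp
qed

lemma lambda_max_pos:
  fixes S :: "real^'n^'n"
  assumes "pos_def_mat S" shows "0 < lambda_max S"
proof -
  obtain k :: 'n where True by simp
  have "axis k 1 \<noteq> (0 :: real^'n)" by simp
  then have "0 < axis k 1 \<bullet> (S *v axis k 1)" using assms unfolding pos_def_mat_def by blast
  also have "\<dots> \<le> lambda_max S"
    using rayleigh_le_lambda_max[OF pos_def_mat_symmetric[OF assms], of "axis k 1"]
    by (simp add: inner_axis)
  finally show ?thesis .
qed

lemma lambda_max_leI:
  assumes "transpose S = S" and le: "\<And>x. x \<bullet> (S *v x) \<le> c * (x \<bullet> x)"
  shows "lambda_max S \<le> c"
proof -
  obtain Q l where Q: "spectral_decomposition S Q l"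
    by (rule symmetric_matrix_spectral[OF assms(1)])
  have "lambda_max S \<in> real_eigenvalues S"
    by (simp add: lambda_max_def spectral_real_eigenvalues[OF Q] Max_in)
  then obtain v where v: "v \<noteq> 0" "S *v v = lambda_max S *\<^sub>R v" by (auto simp: real_eigenvalues_def)
  then have "lambda_max S * (v \<bullet> v) \<le> c * (v \<bullet> v)" using le[of v] by simp
  then show ?thesis using v(1) by simp
qed

lemma norm_matrix_vector_mult_le: "norm (A *v x) \<le> norm A * norm x" for A :: "real^'n^'m"
proof (rule power2_le_imp_le)
  have "(norm (A *v x))\<^sup>2 = (\<Sum>i\<in>UNIV. (A $ i \<bullet> x)\<^sup>2)"
    by (simp only: power2_norm_eq_inner inner_vec_def[of "A *v x"] matrix_vector_mul_component)
       (simp add: power2_eq_square)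
  also have "\<dots> \<le> (\<Sum>i\<in>UNIV. (A $ i \<bullet> A $ i) * (x \<bullet> x))"
    by (intro sum_mono Cauchy_Schwarz_ineq)
  also have "\<dots> = (norm A * norm x)\<^sup>2"
    by (simp add: power_mult_distrib power2_norm_eq_inner inner_vec_def[of A] sum_distrib_right)
  finally show "(norm (A *v x))\<^sup>2 \<le> (norm A * norm x)\<^sup>2" .
qed simp

lemma lambda_max_le_add_norm:
  assumes "transpose S = S" "transpose T = T"
  shows "lambda_max S \<le> lambda_max T + norm (S - T)"
proof (rule lambda_max_leI[OF assms(1)])
  fix x
  have "x \<bullet> ((S - T) *v x) \<le> norm x * (norm (S - T) * norm x)"
    by (intro order_trans[OF norm_cauchy_schwarz] mult_left_mono norm_matrix_vector_mult_le) simp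
  then show "x \<bullet> (S *v x) \<le> (lambda_max T + norm (S - T)) * (x \<bullet> x)"
    using rayleigh_le_lambda_max[OF assms(2), of x]
    by (simp add: matrix_vector_mult_diff_rdistrib inner_diff_right dot_square_norm power2_eq_square
        algebra_simps)
qed

lemma continuous_on_lambda_max: "continuous_on {S. transpose S = S} lambda_max"
proof -
  have "1-lipschitz_on {S. transpose S = S} lambda_max"
  proof (rule lipschitz_onI)
    fix S T :: "real^'n^'n"
    assume "S \<in> {S. transpose S = S}" "T \<in> {S. transpose S = S}"
    then show "dist (lambda_max S) (lambda_max T) \<le> 1 * dist S T"
      using lambda_max_le_add_norm[of S T] lambda_max_le_add_norm[of T S]
      by (simp add: dist_norm norm_minus_commute[of T] abs_le_iff)
  qed simp
  then show ?thesis by (rule lipschitz_on_continuous_on)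
qed

lemma trace_minus_rayleigh_ge:
  fixes S :: "real^'n^'n"
  assumes S: "transpose S = S" "0 \<le> lambda_min S" and s: "x \<bullet> x \<le> s"
  shows "(real CARD('n) - 1) * lambda_min S * s \<le> trace S * s - x \<bullet> (S *v x)"
proof -
  obtain Q l where Q: "spectral_decomposition S Q l"
    by (rule symmetric_matrix_spectral[OF S(1)])
  let ?y = "x v* Q"
  have le_s: "(?y $ i)\<^sup>2 \<le> s" for i
    using member_le_sum[of i UNIV "\<lambda>i. (?y $ i)\<^sup>2"] s by (simp add: spectral_inner_self[OF Q])
  have "lambda_min S * ((real CARD('n) - 1) * s) \<le> lambda_min S * (real CARD('n) * s - x \<bullet> x)"
    using s S(2) by (intro mult_left_mono) (simp_all add: algebra_simps)
  also have "\<dots> = (\<Sum>i\<in>UNIV. lambda_min S * (s - (?y $ i)\<^sup>2))"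
    by (simp add: spectral_inner_self[OF Q] sum_subtractf sum_distrib_left right_diff_distrib)
  also have "\<dots> \<le> (\<Sum>i\<in>UNIV. l i * (s - (?y $ i)\<^sup>2))"
    using le_s by (intro sum_mono mult_right_mono spectral_ge_lambda_min[OF Q]) simp
  also have "\<dots> = trace S * s - x \<bullet> (S *v x)"
    by (simp add: spectral_trace[OF Q] spectral_quadratic_form[OF Q] sum_subtractf sum_distrib_right
        right_diff_distrib)
  finally show ?thesis by (simp add: mult_ac)
qed

subsection \<open>Matrix factorizations\<close>

lemma matrix_mult_matrix_inv:
  fixes A :: "real^'n^'n"
  assumes "invertible A"
  shows "A ** matrix_inv A = mat 1" "matrix_inv A ** A = mat 1"
proof -
  have "A ** matrix_inv A = mat 1 \<and> matrix_inv A ** A = mat 1"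
    using assms unfolding matrix_inv_def invertible_def by (rule someI_ex)
  then show "A ** matrix_inv A = mat 1" "matrix_inv A ** A = mat 1" by simp_all
qed

lemma matrix_inv_cancel:
  fixes A :: "real^'n^'n"
  assumes "invertible A"
  shows "A *v (matrix_inv A *v x) = x" "matrix_inv A *v (A *v x) = x" "(x v* matrix_inv A) v* A = x"
  using matrix_mult_matrix_inv[OF assms]
  by (simp_all add: matrix_vector_mul_assoc vector_matrix_mul_assoc)

lemma pos_def_mat_invertible:
  assumes "pos_def_mat S" shows "invertible S"
proof -
  have "\<forall>x. S *v x = 0 \<longrightarrow> x = 0"
    using assms by (force simp: pos_def_mat_def)
  then show ?thesis by (simp add: invertible_left_inverse matrix_left_invertible_ker)
qed

lemma pos_def_mat_congruence:
  fixes A S :: "real^'n^'n"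
  assumes A: "invertible A" and S: "pos_def_mat S"
  shows "pos_def_mat (A ** S ** transpose A)"
proof -
  have "x v* A \<noteq> 0" if "x \<noteq> 0" for x
  proof
    assume "x v* A = 0"
    moreover have "x \<bullet> x = (x v* A) \<bullet> (matrix_inv A *v x)"
      by (simp add: dot_lmul_matrix matrix_inv_cancel(1)[OF A])
    ultimately show False using that by simp
  qed
  moreover have "x \<bullet> ((A ** S ** transpose A) *v x) = (x v* A) \<bullet> (S *v (x v* A))" for x
    by (simp add: dot_lmul_matrix matrix_vector_mul_assoc[symmetric])
  ultimately show ?thesis
    using S by (simp add: pos_def_mat_def matrix_transpose_mul matrix_mul_assoc)
qed

lemma pos_def_mat_1: "pos_def_mat (mat 1)"
  by (simp add: pos_def_mat_def)

lemma invertible_diag_mat: "(\<And>i. l i \<noteq> 0) \<Longrightarrow> invertible (diag_mat l)"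
  by (simp add: invertible_det_nz det_diag_mat)

lemma orthogonal_matrix_invertible: "orthogonal_matrix Q \<Longrightarrow> invertible Q"
  by (auto simp: orthogonal_matrix_def invertible_def)

lemma pos_def_mat_spectral_factorization:
  fixes S :: "real^'n^'n"
  assumes "pos_def_mat S"
  obtains Q l where "orthogonal_matrix Q" "\<And>i. 0 < l i"
    "S = (Q ** diag_mat l) ** transpose (Q ** diag_mat l)"
proof -
  obtain Q l where Q: "spectral_decomposition S Q l"
    by (rule symmetric_matrix_spectral[OF pos_def_mat_symmetric[OF assms]])
  have l: "0 < l i" for i by (rule spectral_pos[OF Q assms])
  let ?L = "diag_mat (\<lambda>i. sqrt (l i))"
  have "diag_mat l = ?L ** transpose ?L"
    using l by (simp add: transpose_diag_mat diag_mat_mult_diag_mat less_imp_le)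
  then have "S = (Q ** ?L) ** transpose (Q ** ?L)"
    using Q by (simp add: spectral_decomposition_def matrix_transpose_mul matrix_mul_assoc)
  with that[of Q "\<lambda>i. sqrt (l i)"] show ?thesis
    using l spectral_orthogonal[OF Q] by simp
qed

lemma pos_def_mat_factorization:
  fixes S :: "real^'n^'n"
  assumes "pos_def_mat S"
  obtains A :: "real^'n^'n" where "invertible A" "S = A ** transpose A"
proof -
  obtain Q l where "orthogonal_matrix Q" "\<And>i. 0 < l i"
    "S = (Q ** diag_mat l) ** transpose (Q ** diag_mat l)"
    using pos_def_mat_spectral_factorization[OF assms] by blast
  then show ?thesis
    by (intro that[of "Q ** diag_mat l"] invertible_mult orthogonal_matrix_invertible
        invertible_diag_mat)
      (simp_all add: less_imp_neq[THEN not_sym])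
qed

lemma det_pos_def_mat:
  fixes S :: "real^'n^'n"
  assumes "pos_def_mat S" shows "0 < det S"
proof -
  obtain A :: "real^'n^'n" where "invertible A" "S = A ** transpose A"
    by (rule pos_def_mat_factorization[OF assms])
  then show ?thesis by (simp add: det_mul invertible_det_nz power2_eq_square[symmetric])
qed

lemma norm_mult_le_sqrt_lambda_max:
  fixes A :: "real^'n^'n"
  shows "norm (A *v y) \<le> sqrt (lambda_max (A ** transpose A)) * norm y"
proof -
  let ?L = "lambda_max (A ** transpose A)" and ?z = "A *v y"
  have le_sq: "(norm (x v* A))\<^sup>2 \<le> ?L * (norm x)\<^sup>2" for x
    using rayleigh_le_lambda_max[of "A ** transpose A" x]
    by (simp add: matrix_transpose_mul matrix_vector_mul_assoc[symmetric] dot_lmul_matrix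
        power2_norm_eq_inner)
  obtain k :: 'n where True by simp
  have L: "0 \<le> ?L" using order_trans[OF zero_le_power2 le_sq[of "axis k 1"]] by simp
  have "norm ?z * norm ?z = (?z v* A) \<bullet> y"
    by (simp add: dot_lmul_matrix dot_square_norm power2_eq_square)
  also have "\<dots> \<le> norm (?z v* A) * norm y" by (rule norm_cauchy_schwarz)
  also have "norm (?z v* A) \<le> sqrt ?L * norm ?z"
    using real_sqrt_le_mono[OF le_sq[of ?z]] by (simp add: real_sqrt_mult)
  finally have "norm ?z * norm ?z \<le> norm ?z * (sqrt ?L * norm y)"
    by (simp add: mult_right_mono mult_ac)
  then show ?thesis using L by (cases "?z = 0") simp_all
qed

lemma singular_value_decomposition:
  fixes A :: "real^'n^'n"
  assumes "invertible A"
  obtains Q l R where "orthogonal_matrix Q" "orthogonal_matrix R" "\<And>i. 0 < l i"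
    "A = Q ** diag_mat l ** R"
proof -
  obtain Q l where Q: "orthogonal_matrix Q" and l: "\<And>i. 0 < l i"
    and AA: "A ** transpose A = (Q ** diag_mat l) ** transpose (Q ** diag_mat l)"
    using pos_def_mat_spectral_factorization pos_def_mat_congruence[OF assms pos_def_mat_1]
    by (metis matrix_mul_rid)
  define L where "L = Q ** diag_mat l"
  define K where "K = diag_mat (\<lambda>i. 1 / l i) ** transpose Q"
  have "K ** L = diag_mat (\<lambda>i. 1 / l i) ** (transpose Q ** Q) ** diag_mat l"
    by (simp add: K_def L_def matrix_mul_assoc)
  also have "\<dots> = mat 1"
    using Q l
    by (simp add: orthogonal_matrix_def diag_mat_mult_diag_mat less_imp_neq[THEN not_sym] diag_mat_1)
  finally have KL: "K ** L = mat 1" .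
  then have LK: "L ** K = mat 1" by (simp add: matrix_left_right_inverse)
  define R where "R = K ** A"
  have "R ** transpose R = K ** (A ** transpose A) ** transpose K"
    by (simp add: R_def matrix_transpose_mul matrix_mul_assoc)
  also have "\<dots> = (K ** L) ** transpose (K ** L)"
    by (simp add: AA L_def[symmetric] matrix_transpose_mul matrix_mul_assoc)
  finally have "R ** transpose R = mat 1" by (simp add: KL)
  then have "orthogonal_matrix R"
    using matrix_left_right_inverse[of R "transpose R"] by (simp add: orthogonal_matrix_def)
  moreover have "A = L ** R" by (simp add: R_def matrix_mul_assoc LK)
  ultimately show ?thesis using that[OF Q _ l] by (simp add: L_def)
qed

subsection \<open>Linear changes of variables for Lebesgue measure\<close>

lemma nn_integral_lborel_translate:
  fixes f :: "'a::euclidean_space \<Rightarrow> ennreal"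
  assumes [measurable]: "f \<in> borel_measurable borel"
  shows "(\<integral>\<^sup>+x. f (t + x) \<partial>lborel) = (\<integral>\<^sup>+x. f x \<partial>lborel)"
  by (subst (2) lborel_distr_plus[of t, symmetric]) (simp add: nn_integral_distr)

text \<open>Uniqueness of Haar measure: \<open>B\<close> serves to calibrate \<open>M\<close> against Lebesgue measure.\<close>
lemma translation_invariant_emeasure_mult:
  fixes M :: "'a::euclidean_space measure"
  assumes "sigma_finite_measure M" and [measurable_cong]: "sets M = sets borel"
    and invariant: "\<And>t. distr M borel ((+) t) = M"
    and [measurable]: "A \<in> sets borel" "B \<in> sets borel"
  shows "emeasure M A * emeasure lborel B = emeasure lborel A * emeasure M (uminus -` B)"
proof -
  interpret pair_sigma_finite M "lborel :: 'a measure"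
    by (intro pair_sigma_finite.intro assms(1) sigma_finite_lborel)
  have translate: "(\<integral>\<^sup>+x. f (t + x) \<partial>M) = (\<integral>\<^sup>+x. f x \<partial>M)"
    if [measurable]: "f \<in> borel_measurable borel" for f t
    by (subst (2) invariant[of t, symmetric]) (simp add: nn_integral_distr)
  have [measurable]: "uminus -` B \<in> sets borel"
    by (rule measurable_sets_borel[of uminus borel]) measurable
  have "emeasure M A * emeasure lborel B = (\<integral>\<^sup>+x. indicator A x * emeasure lborel B \<partial>M)"
    by (simp add: nn_integral_multc)
  also have "\<dots> = (\<integral>\<^sup>+x. (\<integral>\<^sup>+y. indicator A x * indicator B (- x + y) \<partial>lborel) \<partial>M)"
    by (simp add: nn_integral_cmult nn_integral_lborel_translate[where f="indicator B"]
        del: uminus_add_conv_diff)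
  also have "\<dots> = (\<integral>\<^sup>+y. (\<integral>\<^sup>+x. indicator A x * indicator B (- x + y) \<partial>M) \<partial>lborel)"
    by (rule Fubini'[symmetric]) measurable
  also have "\<dots> = (\<integral>\<^sup>+y. (\<integral>\<^sup>+x. indicator A (y + x) * indicator B (- (y + x) + y) \<partial>M) \<partial>lborel)"
    by (intro nn_integral_cong translate[symmetric]) measurable
  also have "\<dots> = (\<integral>\<^sup>+y. (\<integral>\<^sup>+x. indicator A (x + y) * indicator (uminus -` B) x \<partial>M) \<partial>lborel)"
    by (simp add: add.commute indicator_def)
  also have "\<dots> = (\<integral>\<^sup>+x. (\<integral>\<^sup>+y. indicator A (x + y) * indicator (uminus -` B) x \<partial>lborel) \<partial>M)"
    by (rule Fubini') measurable
  also have "\<dots> = emeasure lborel A * emeasure M (uminus -` B)"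
    by (simp add: nn_integral_multc nn_integral_cmult
        nn_integral_lborel_translate[where f="indicator A"])
  finally show ?thesis .
qed

lemma sigma_finite_measure_if_cball_finite:
  fixes M :: "'a::euclidean_space measure"
  assumes "sets M = sets borel" and "\<And>n. emeasure M (cball 0 (real n)) \<noteq> \<infinity>"
  shows "sigma_finite_measure M"
proof
  have "x \<in> (\<Union>n. cball 0 (real n))" for x :: 'a
    using real_arch_simple[of "norm x"] by auto
  moreover have "space M = UNIV" using sets_eq_imp_space_eq[OF assms(1)] by simp
  ultimately show "\<exists>A. countable A \<and> A \<subseteq> sets M \<and> \<Union>A = space M \<and> (\<forall>a\<in>A. emeasure M a \<noteq> \<infinity>)"
    using assms by (intro exI[of _ "range (\<lambda>n. cball 0 (real n))"]) auto
qed

lemma lborel_distr_orthogonal_transformation: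
  fixes f :: "'a::euclidean_space \<Rightarrow> 'a"
  assumes f: "orthogonal_transformation f"
  shows "distr lborel borel f = lborel" (is "?M = _")
proof (rule measure_eqI)
  fix A assume "A \<in> sets ?M"
  then have [measurable]: "A \<in> sets borel" by simp
  have lin: "linear f" using f by (rule orthogonal_transformation_linear)
  have [measurable]: "f \<in> borel_measurable borel"
    using lin
    by (intro borel_measurable_continuous_onI linear_continuous_on
        linear_conv_bounded_linear[THEN iffD1])
  have "f -` cball 0 r = cball 0 r" for r
    using orthogonal_transformation_norm[OF f] by auto
  then have ball: "emeasure ?M (cball 0 r) = emeasure lborel (cball (0::'a) r)" for r
    by (simp add: emeasure_distr)
  have invariant: "distr ?M borel ((+) t) = ?M" for t
  proof -
    obtain s where s: "f s = t" using orthogonal_transformation_surj[OF f] by (metis surjD)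
    have "distr ?M borel ((+) t) = distr (distr lborel borel ((+) s)) borel f"
      by (simp add: distr_distr comp_def linear_add[OF lin] s)
    then show ?thesis by (simp add: lborel_distr_plus)
  qed
  let ?B = "cball (0::'a) 1"
  have "emeasure ?M A * emeasure lborel ?B = emeasure lborel A * emeasure ?M (uminus -` ?B)"
    using ball
    by (intro translation_invariant_emeasure_mult invariant sigma_finite_measure_if_cball_finite)
      (simp_all add: emeasure_cball)
  also have "uminus -` ?B = ?B" by auto
  finally have "emeasure ?M A * emeasure lborel ?B = emeasure lborel A * emeasure lborel ?B"
    by (simp only: ball)
  moreover have "emeasure lborel ?B \<noteq> 0" "emeasure lborel ?B \<noteq> \<infinity>"
    using unit_ball_vol_pos[of "real DIM('a)"]
    by (auto simp: emeasure_cball simp del: unit_ball_vol_pos)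
  ultimately show "emeasure ?M A = emeasure lborel A"
    by (metis ennreal_mult_divide_eq infinity_ennreal_def)
qed simp

lemma borel_measurable_vec_nth [measurable (raw)]:
  fixes f :: "'a \<Rightarrow> 'b::topological_space^'n"
  assumes "f \<in> borel_measurable M"
  shows "(\<lambda>\<omega>. f \<omega> $ i) \<in> borel_measurable M"
  using assms by (rule measurable_compose) (intro borel_measurable_continuous_onI continuous_intros)

lemma borel_measurable_matrix_vector_mult [measurable]: "(*v) (A :: real^'n^'m) \<in> borel_measurable borel"
  by (intro borel_measurable_continuous_onI linear_continuous_on matrix_vector_mul_bounded_linear)

lemma nn_integral_lborel_orthogonal_matrix:
  fixes Q :: "real^'n^'n"
  assumes "orthogonal_matrix Q" and [measurable]: "f \<in> borel_measurable borel"
  shows "(\<integral>\<^sup>+x. f (Q *v x) \<partial>lborel) = (\<integral>\<^sup>+x. f x \<partial>lborel)"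
proof -
  have "distr lborel borel ((*v) Q) = lborel"
    using assms(1)
    by (intro lborel_distr_orthogonal_transformation) (simp add: orthogonal_transformation_matrix)
  then show ?thesis using nn_integral_distr[of "(*v) Q" lborel borel f] by simp
qed

lemma nn_integral_lborel_diag_mat:
  fixes l :: "'n::finite \<Rightarrow> real"
  assumes l: "\<And>i. l i \<noteq> 0" and [measurable]: "f \<in> borel_measurable borel"
  shows "(\<integral>\<^sup>+x. f x \<partial>lborel) = ennreal (\<Prod>i\<in>UNIV. \<bar>l i\<bar>) * (\<integral>\<^sup>+x. f (diag_mat l *v x) \<partial>lborel)"
proof -
  define w where "w = (\<chi> i. l i)"
  have "(\<lambda>x. 0 + (\<Sum>j\<in>Basis. (w \<bullet> j * (x \<bullet> j)) *\<^sub>R j)) = (*v) (diag_mat l)"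
  proof (rule ext, rule euclidean_eqI)
    fix x b :: "real^'n" assume b: "b \<in> Basis"
    then have "(0 + (\<Sum>j\<in>Basis. (w \<bullet> j * (x \<bullet> j)) *\<^sub>R j)) \<bullet> b = w \<bullet> b * (x \<bullet> b)" by simp
    also have "\<dots> = (diag_mat l *v x) \<bullet> b"
      using b by (auto simp: Basis_vec_def inner_axis w_def diag_mat_mult_vec)
    finally show "(0 + (\<Sum>j\<in>Basis. (w \<bullet> j * (x \<bullet> j)) *\<^sub>R j)) \<bullet> b = (diag_mat l *v x) \<bullet> b" .
  qed
  moreover have "bij_betw (\<lambda>i. axis i (1::real)) (UNIV :: 'n set) Basis"
    by (auto simp: bij_betw_def inj_on_def axis_eq_axis Basis_vec_def)
  then have "(\<Prod>j\<in>Basis. \<bar>w \<bullet> j\<bar>) = (\<Prod>i\<in>UNIV. \<bar>l i\<bar>)"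
    by (subst prod.reindex_bij_betw[symmetric]) (auto simp: inner_axis w_def)
  moreover have "w \<bullet> j \<noteq> 0" if "j \<in> Basis" for j
    using that l by (auto simp: Basis_vec_def inner_axis w_def)
  ultimately have "lborel
      = density (distr lborel borel ((*v) (diag_mat l))) (\<lambda>_. ennreal (\<Prod>i\<in>UNIV. \<bar>l i\<bar>))"
    using lborel_affine_euclidean[of "\<lambda>j. w \<bullet> j" 0] by simp
  then have "(\<integral>\<^sup>+x. f x \<partial>lborel)
      = (\<integral>\<^sup>+x. f x \<partial>density (distr lborel borel ((*v) (diag_mat l))) (\<lambda>_. ennreal (\<Prod>i\<in>UNIV. \<bar>l i\<bar>)))"
    by (rule arg_cong)
  also have "\<dots> = ennreal (\<Prod>i\<in>UNIV. \<bar>l i\<bar>) * (\<integral>\<^sup>+x. f (diag_mat l *v x) \<partial>lborel)"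
    by (subst nn_integral_density) (simp_all add: nn_integral_distr nn_integral_cmult)
  finally show ?thesis .
qed

text \<open>The change of variables in \<open>HOL-Analysis\<close> is restricted to well-ordered index types.\<close>
lemma nn_integral_lborel_matrix:
  fixes A :: "real^'n^'n"
  assumes A: "invertible A" and [measurable]: "f \<in> borel_measurable borel"
  shows "(\<integral>\<^sup>+x. f x \<partial>lborel) = ennreal \<bar>det A\<bar> * (\<integral>\<^sup>+x. f (A *v x) \<partial>lborel)"
proof -
  obtain Q l R where Q: "orthogonal_matrix Q" and R: "orthogonal_matrix R" and l: "\<And>i. 0 < l i"
    and QlR: "A = Q ** diag_mat l ** R"
    using singular_value_decomposition[OF A] by metis
  have "(\<integral>\<^sup>+x. f x \<partial>lborel) = (\<integral>\<^sup>+x. f (Q *v x) \<partial>lborel)"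
    by (rule nn_integral_lborel_orthogonal_matrix[OF Q, symmetric]) measurable
  also have "\<dots> = ennreal (\<Prod>i\<in>UNIV. \<bar>l i\<bar>) * (\<integral>\<^sup>+x. f (Q *v (diag_mat l *v x)) \<partial>lborel)"
    using l by (intro nn_integral_lborel_diag_mat) (auto simp: less_imp_neq[THEN not_sym])
  also have "(\<integral>\<^sup>+x. f (Q *v (diag_mat l *v x)) \<partial>lborel)
      = (\<integral>\<^sup>+x. f (Q *v (diag_mat l *v (R *v x))) \<partial>lborel)"
    by (rule nn_integral_lborel_orthogonal_matrix[OF R, symmetric]) measurable
  also have "\<dots> = (\<integral>\<^sup>+x. f (A *v x) \<partial>lborel)"
    by (simp add: QlR matrix_vector_mul_assoc matrix_mul_assoc)
  also have "(\<Prod>i\<in>UNIV. \<bar>l i\<bar>) = \<bar>det A\<bar>"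
    using det_orthogonal_matrix[OF Q] det_orthogonal_matrix[OF R]
    by (auto simp: QlR det_mul det_diag_mat abs_mult abs_prod)
  finally show ?thesis .
qed

subsection \<open>Centred normal distributions\<close>

lemma borel_measurable_mvn_density [measurable]: "mvn_density S \<in> borel_measurable borel"
  unfolding mvn_density_def by measurable

lemma sets_normal_vec [measurable_cong, simp]: "sets (normal_vec S) = sets borel"
  and space_normal_vec [simp]: "space (normal_vec S) = UNIV"
  by (simp_all add: normal_vec_def)

lemma nn_integral_normal_vec:
  "f \<in> borel_measurable borel \<Longrightarrow>
      (\<integral>\<^sup>+x. f x \<partial>normal_vec S) = (\<integral>\<^sup>+x. ennreal (mvn_density S x) * f x \<partial>lborel)"
  unfolding normal_vec_def by (subst nn_integral_density) auto

lemma mvn_density_linear_image: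
  fixes A S :: "real^'n^'n"
  assumes A: "invertible A" and S: "invertible S"
  shows "\<bar>det A\<bar> * mvn_density (A ** S ** transpose A) (A *v x) = mvn_density S x"
proof -
  define T where "T = A ** S ** transpose A"
  define z where "z = matrix_inv S *v x"
  have T: "invertible T"
    using A S by (simp add: T_def invertible_mult transpose_invertible)
  have "T *v (z v* matrix_inv A) = A *v x"
    by (simp add: T_def z_def matrix_vector_mul_assoc[symmetric] matrix_inv_cancel[OF A]
        matrix_inv_cancel[OF S])
  then have "matrix_inv T *v (A *v x) = z v* matrix_inv A"
    using matrix_inv_cancel(2)[OF T] by metis
  then have "(matrix_inv T *v (A *v x)) \<bullet> (A *v x) = z \<bullet> x"
    by (simp add: dot_lmul_matrix matrix_inv_cancel(2)[OF A])
  then have "(A *v x) \<bullet> (matrix_inv T *v (A *v x)) = x \<bullet> (matrix_inv S *v x)"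
    by (simp add: z_def inner_commute)
  moreover have "det T = (det A)\<^sup>2 * det S" by (simp add: T_def det_mul power2_eq_square)
  then have "sqrt ((2 * pi) ^ CARD('n) * det T) = \<bar>det A\<bar> * sqrt ((2 * pi) ^ CARD('n) * det S)"
    by (simp add: real_sqrt_mult)
  moreover have "det A \<noteq> 0" using A by (simp add: invertible_det_nz)
  ultimately show ?thesis by (simp add: mvn_density_def T_def[symmetric])
qed

lemma normal_vec_linear_image:
  fixes A S :: "real^'n^'n"
  assumes A: "invertible A" and S: "invertible S"
  shows "normal_vec (A ** S ** transpose A) = distr (normal_vec S) borel ((*v) A)"
proof (rule measure_eqI)
  let ?T = "A ** S ** transpose A"
  fix X assume "X \<in> sets (normal_vec ?T)"
  then have [measurable]: "X \<in> sets borel" by simp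
  have "emeasure (normal_vec ?T) X = (\<integral>\<^sup>+x. ennreal (mvn_density ?T x) * indicator X x \<partial>lborel)"
    by (simp add: normal_vec_def emeasure_density)
  also have "\<dots> = ennreal \<bar>det A\<bar>
      * (\<integral>\<^sup>+x. ennreal (mvn_density ?T (A *v x)) * indicator X (A *v x) \<partial>lborel)"
    by (rule nn_integral_lborel_matrix[OF A]) measurable
  also have "\<dots> = (\<integral>\<^sup>+x. ennreal (mvn_density S x) * indicator X (A *v x) \<partial>lborel)"
    by (simp add: nn_integral_cmult[symmetric] mult.assoc[symmetric] ennreal_mult'[symmetric]
        mvn_density_linear_image[OF A S])
  also have "\<dots> = (\<integral>\<^sup>+x. indicator X x \<partial>distr (normal_vec S) borel ((*v) A))"
    by (subst nn_integral_distr) (simp_all add: nn_integral_normal_vec)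
  finally show "emeasure (normal_vec ?T) X = emeasure (distr (normal_vec S) borel ((*v) A)) X" by simp
qed simp

lemma mvn_density_nonneg: "pos_def_mat S \<Longrightarrow> 0 \<le> mvn_density S x"
  using det_pos_def_mat[of S] by (simp add: mvn_density_def)

lemma integral_normal_vec:
  fixes f :: "real^'n \<Rightarrow> real"
  assumes "pos_def_mat S" and [measurable]: "f \<in> borel_measurable borel"
  shows "integrable (normal_vec S) f \<longleftrightarrow> integrable lborel (\<lambda>x. mvn_density S x * f x)"
    and "(\<integral>x. f x \<partial>normal_vec S) = (\<integral>x. mvn_density S x * f x \<partial>lborel)"
  using assms unfolding normal_vec_def
  by (simp_all add: integrable_density integral_density mvn_density_nonneg)

lemma normal_vec_std_image:
  fixes S :: "real^'n^'n"
  assumes "pos_def_mat S"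
  obtains A :: "real^'n^'n" where "normal_vec S = distr (normal_vec (mat 1)) borel ((*v) A)"
    "\<And>y. norm (A *v y) \<le> sqrt (lambda_max S) * norm y"
proof -
  obtain A :: "real^'n^'n" where A: "invertible A" "S = A ** transpose A"
    by (rule pos_def_mat_factorization[OF assms])
  have "normal_vec S = distr (normal_vec (mat 1)) borel ((*v) A)"
    using normal_vec_linear_image[OF A(1) pos_def_mat_invertible[OF pos_def_mat_1]]
    by (simp add: A(2))
  moreover have "norm (A *v y) \<le> sqrt (lambda_max S) * norm y" for y
    unfolding A(2) by (rule norm_mult_le_sqrt_lambda_max)
  ultimately show ?thesis by (rule that)
qed

lemma mvn_density_std: "mvn_density (mat 1) x = exp (- (norm x)\<^sup>2 / 2) / sqrt ((2 * pi) ^ CARD('n))"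
  for x :: "real^'n"
proof -
  have "matrix_inv (mat 1) *v x = x"
    using matrix_inv_cancel(2)[OF pos_def_mat_invertible[OF pos_def_mat_1], of x] by simp
  then show ?thesis by (simp add: mvn_density_def dot_square_norm)
qed

subsection \<open>Radial integrals\<close>

lemma distr_norm_lborel:
  "distr (lborel :: 'a::euclidean_space measure) borel norm
    = density lborel
      (\<lambda>r. ennreal (real DIM('a) * unit_ball_vol DIM('a) * r ^ (DIM('a) - 1)) * indicator {0..} r)"
  (is "?M = ?N")
proof (rule measure_eqI_generator_eq[where E="range atMost" and \<Omega>=UNIV and A="\<lambda>i. {..real i}"])
  let ?d = "DIM('a)" let ?c = "unit_ball_vol DIM('a)"
  have M: "emeasure ?M {..r} = ennreal (if r < 0 then 0 else ?c * r ^ ?d)" for r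
  proof -
    have "norm -` {..r} = cball (0::'a) r" by auto
    then show ?thesis by (auto simp: emeasure_distr emeasure_cball)
  qed
  show "emeasure ?M X = emeasure ?N X" if "X \<in> range atMost" for X
  proof -
    from that obtain r where X: "X = {..r}" by auto
    have "emeasure ?N X = (\<integral>\<^sup>+s. ennreal (?d * ?c * s ^ (?d - 1)) * indicator {0..r} s \<partial>lborel)"
      unfolding X by (subst emeasure_density) (auto intro!: nn_integral_cong simp: indicator_def)
    also have "\<dots> = ennreal (if r < 0 then 0 else ?c * r ^ ?d)"
    proof (cases "r < 0")
      case False
      have "((\<lambda>s. ?c * s ^ ?d) has_real_derivative ?d * ?c * s ^ (?d - 1)) (at s)" for s
        by (auto intro!: derivative_eq_intros)
      then show ?thesis using False
        by (subst nn_integral_FTC_Icc[where F="\<lambda>s. ?c * s ^ ?d"])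
          (auto intro: has_field_derivative_at_within)
    qed simp
    finally show ?thesis by (simp add: X M)
  qed
  show "emeasure ?M {..real i} \<noteq> \<infinity>" for i by (simp only: M) simp
  show "Int_stable (range (atMost :: real \<Rightarrow> _))" by (auto simp: Int_stable_def)
  show "(\<Union>i. {..real i}) = UNIV" using real_arch_simple by auto
qed (auto simp: borel_eq_atMost)

definition chi_const :: "nat \<Rightarrow> real" where
  "chi_const n = 2 powr (real n / 2 - 1) * Gamma (real n / 2)"

lemma chi_const_pos: "0 < n \<Longrightarrow> 0 < chi_const n"
  by (simp add: chi_const_def Gamma_real_pos)

lemma gaussian_polar_normalization:
  assumes "n > 0"
  shows "real n * unit_ball_vol n / sqrt ((2 * pi) ^ n) = 1 / chi_const n"
proof -
  have "Gamma (real n / 2 + 1) = real n / 2 * Gamma (real n / 2)"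
    using assms by (subst Gamma_plus1) (auto elim!: nonpos_Ints_cases)
  moreover have "sqrt ((2 * pi) ^ n) = 2 powr (real n / 2) * pi powr (real n / 2)"
    by (simp add: powr_half_sqrt[symmetric] powr_realpow[symmetric] powr_powr powr_mult)
  moreover have "Gamma (real n / 2) > 0" using assms by (simp add: Gamma_real_pos)
  moreover have "2 powr (real n / 2 - 1) = 2 powr (real n / 2) / (2::real)" by (simp add: powr_diff)
  ultimately show ?thesis
    using assms by (simp only: unit_ball_vol_def chi_const_def) (simp add: field_simps)
qed

lemma has_bochner_integral_std_normal_radial:
  fixes f :: "real \<Rightarrow> real"
  assumes [measurable]: "f \<in> borel_measurable borel" and f: "\<And>r. 0 \<le> r \<Longrightarrow> 0 \<le> f r"
    and I: "((\<lambda>r. r ^ (CARD('n) - 1) * exp (- r\<^sup>2 / 2) * f r) has_integral I) {0..}"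
  shows "has_bochner_integral (normal_vec (mat 1 :: real^'n^'n)) (\<lambda>y. f (norm y)) (I / chi_const CARD('n))"
proof (rule has_bochner_integral_nn_integral)
  let ?n = "CARD('n)" and ?N = "normal_vec (mat 1 :: real^'n^'n)"
  let ?g = "\<lambda>r. r ^ (?n - 1) * exp (- r\<^sup>2 / 2) * f r / chi_const ?n"
  let ?v = "real ?n * unit_ball_vol ?n"
  let ?\<phi> = "\<lambda>r. exp (- r\<^sup>2 / 2) / sqrt ((2 * pi) ^ ?n)"
  have g: "(?g has_integral I / chi_const ?n) {0..}"
    by (rule has_integral_divide[OF I])
  have g_nonneg: "0 \<le> ?g r" if "r \<in> {0..}" for r
    using that f chi_const_pos[of ?n] by simp
  have density: "ennreal (?v * r ^ (?n - 1)) * ennreal (?\<phi> r * f r) = ennreal (?g r)" if "0 \<le> r" for r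
  proof -
    have "?v * r ^ (?n - 1) * (?\<phi> r * f r)
        = r ^ (?n - 1) * exp (- r\<^sup>2 / 2) * f r * (?v / sqrt ((2 * pi) ^ ?n))"
      by simp
    also have "\<dots> = ?g r"
      by (simp only: gaussian_polar_normalization[OF zero_less_card_finite]) simp
    finally show ?thesis
      using that f by (subst ennreal_mult[symmetric]) (simp_all only: mult_nonneg_nonneg, simp_all)
  qed
  have "(\<integral>\<^sup>+y. ennreal (f (norm y)) \<partial>?N) = (\<integral>\<^sup>+y. ennreal (?\<phi> (norm (y::real^'n)) * f (norm y)) \<partial>lborel)"
    by (simp add: nn_integral_normal_vec mvn_density_std ennreal_mult f del: times_divide_eq_left)
  also have "\<dots> = (\<integral>\<^sup>+r. ennreal (?\<phi> r * f r) \<partial>distr (lborel :: (real^'n) measure) borel norm)"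
    by (simp add: nn_integral_distr)
  also have "\<dots> = (\<integral>\<^sup>+r. ennreal (?v * r ^ (?n - 1)) * indicator {0..} r * ennreal (?\<phi> r * f r) \<partial>lborel)"
    by (simp add: distr_norm_lborel nn_integral_density)
  also have "\<dots> = (\<integral>\<^sup>+r. ennreal (?g r) * indicator {0..} r \<partial>lborel)"
    using density by (intro nn_integral_cong) (simp add: indicator_def)
  also have "\<dots> = ennreal (I / chi_const ?n)"
    by (rule nn_integral_has_integral_lebesgue'[OF g_nonneg g])
  finally show "(\<integral>\<^sup>+y. ennreal (f (norm y)) \<partial>?N) = ennreal (I / chi_const ?n)" .
  show "0 \<le> I / chi_const ?n" by (rule has_integral_nonneg[OF g g_nonneg])
qed (simp_all add: f)

lemma has_integral_half_square_substitution:
  fixes f :: "real \<Rightarrow> real"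
  assumes f: "(f has_integral I) {0..}" and nonneg: "\<And>t. 0 \<le> t \<Longrightarrow> 0 \<le> f t"
  shows "((\<lambda>r. r * f (r\<^sup>2 / 2)) has_integral I) {0..}"
proof -
  have "(\<lambda>r::real. r\<^sup>2 / 2) ` {0..} = {0..}"
  proof (intro equalityI subsetI)
    fix y :: real assume "y \<in> {0..}"
    then show "y \<in> (\<lambda>r. r\<^sup>2 / 2) ` {0..}" by (intro image_eqI[of _ _ "sqrt (2 * y)"]) auto
  qed auto
  moreover have "f absolutely_integrable_on {0..}"
    using f nonneg by (intro nonnegative_absolutely_integrable_1) (auto simp: has_integral_integrable)
  ultimately have "f absolutely_integrable_on (\<lambda>r::real. r\<^sup>2 / 2) ` {0..}
      \<and> integral ((\<lambda>r::real. r\<^sup>2 / 2) ` {0..}) f = I"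
    using f by (simp add: integral_unique)
  moreover have "inj_on (\<lambda>r::real. r\<^sup>2 / 2) {0..}"
    by (auto simp: inj_on_def)
  ultimately have "(\<lambda>r. \<bar>r\<bar> * f (r\<^sup>2 / 2)) absolutely_integrable_on {0..}
      \<and> integral {0..} (\<lambda>r. \<bar>r\<bar> * f (r\<^sup>2 / 2)) = I"
    by (subst has_absolute_integral_change_of_variables_1') (auto intro!: derivative_eq_intros)
  then have "((\<lambda>r. \<bar>r\<bar> * f (r\<^sup>2 / 2)) has_integral I) {0..}"
    by (auto simp: has_integral_iff dest: set_lebesgue_integral_eq_integral(1))
  then show ?thesis by (rule has_integral_eq[rotated]) simp
qed

lemma chi_const_Suc: "chi_const (Suc j) = 2 powr ((real j - 1) / 2) * Gamma ((real j + 1) / 2)"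
proof -
  have "real (Suc j) / 2 - 1 = (real j - 1) / 2" "real (Suc j) / 2 = (real j + 1) / 2"
    by (simp_all add: field_simps)
  then show ?thesis by (simp only: chi_const_def)
qed

lemma has_integral_gaussian_moment: "((\<lambda>r. r ^ j * exp (- r\<^sup>2 / 2)) has_integral chi_const (Suc j)) {0..}"
proof -
  define x where "x = real (Suc j) / 2"
  have "((\<lambda>t. t powr (x - 1) / exp t) has_integral Gamma x) {0..}"
    by (rule Gamma_integral_real) (simp add: x_def)
  then have "((\<lambda>r. r * ((r\<^sup>2 / 2) powr (x - 1) / exp (r\<^sup>2 / 2))) has_integral Gamma x) {0..}"
    by (rule has_integral_half_square_substitution) simp
  then have scaled: "((\<lambda>r. 2 powr (x - 1) * (r * ((r\<^sup>2 / 2) powr (x - 1) / exp (r\<^sup>2 / 2))))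
      has_integral (2 powr (x - 1) * Gamma x)) {0..}"
    by (rule has_integral_mult_right)
  have "r ^ j * exp (- r\<^sup>2 / 2) = 2 powr (x - 1) * (r * ((r\<^sup>2 / 2) powr (x - 1) / exp (r\<^sup>2 / 2)))"
    if "r \<in> {0..} - {0}" for r
  proof -
    have r: "r > 0" using that by auto
    have "(r\<^sup>2 / 2) powr (x - 1) = r powr (2 * (x - 1)) / 2 powr (x - 1)"
      using r by (simp add: powr_divide powr_powr powr_realpow[symmetric] del: powr_numeral)
    moreover have "r * r powr (2 * (x - 1)) = r powr (1 + 2 * (x - 1))"
      using r by (simp only: powr_add powr_one)
    moreover have "1 + 2 * (x - 1) = real j" by (simp add: x_def field_simps)
    ultimately show ?thesis using r by (simp add: exp_minus powr_realpow field_simps)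
  qed
  then have "((\<lambda>r. r ^ j * exp (- r\<^sup>2 / 2)) has_integral (2 powr (x - 1) * Gamma x)) {0..}"
    by (rule has_integral_spike[OF negligible_sing _ scaled])
  then show ?thesis by (simp only: x_def chi_const_def)
qed

lemma has_bochner_integral_std_normal_norm_power:
  "has_bochner_integral (normal_vec (mat 1 :: real^'n^'n)) (\<lambda>y. norm y ^ k)
    (chi_const (CARD('n) + k) / chi_const CARD('n))"
proof (rule has_bochner_integral_std_normal_radial)
  let ?n = "CARD('n)"
  have "r ^ (?n - 1 + k) * exp (- r\<^sup>2 / 2) = r ^ (?n - 1) * exp (- r\<^sup>2 / 2) * r ^ k" for r :: real
    by (simp only: power_add mult_ac)
  moreover have "Suc (?n - 1 + k) = ?n + k" by simp
  ultimately show "((\<lambda>r. r ^ (?n - 1) * exp (- r\<^sup>2 / 2) * r ^ k) has_integral chi_const (?n + k)) {0..}"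
    using has_integral_gaussian_moment[of "?n - 1 + k"] by (simp only:)
qed simp_all

lemma prob_space_normal_vec_std: "prob_space (normal_vec (mat 1 :: real^'n^'n))"
proof -
  have "has_bochner_integral (normal_vec (mat 1 :: real^'n^'n)) (\<lambda>_. 1) (1::real)"
    using has_bochner_integral_std_normal_norm_power[where 'n='n, of 0] chi_const_pos[of "CARD('n)"]
    by simp
  then have "(\<integral>\<^sup>+x. ennreal 1 \<partial>normal_vec (mat 1 :: real^'n^'n)) = ennreal 1"
    by (intro nn_integral_eq_integral[THEN trans]) (auto simp: has_bochner_integral_iff)
  then show ?thesis by (intro prob_spaceI) simp
qed

lemma prob_space_normal_vec:
  fixes S :: "real^'n^'n"
  assumes "pos_def_mat S" shows "prob_space (normal_vec S)"
proof -
  obtain A :: "real^'n^'n" where A: "normal_vec S = distr (normal_vec (mat 1)) borel ((*v) A)"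
    by (rule normal_vec_std_image[OF assms])
  show ?thesis unfolding A by (rule prob_space.prob_space_distr[OF prob_space_normal_vec_std]) measurable
qed

lemma integral_normal_vec_norm_sq_le:
  fixes S :: "real^'n^'n"
  assumes S: "pos_def_mat S"
  shows "integrable (normal_vec S) (\<lambda>x. (norm x)\<^sup>2)"
    and "(\<integral>x. (norm x)\<^sup>2 \<partial>normal_vec S) \<le> lambda_max S * (\<integral>y. (norm y)\<^sup>2 \<partial>normal_vec (mat 1 :: real^'n^'n))"
proof -
  let ?N = "normal_vec (mat 1 :: real^'n^'n)"
  obtain A where A: "normal_vec S = distr ?N borel ((*v) A)"
    "\<And>y. norm (A *v y) \<le> sqrt (lambda_max S) * norm y"
    using normal_vec_std_image[OF S] by blast
  have bound: "(norm (A *v y))\<^sup>2 \<le> lambda_max S * (norm y)\<^sup>2" for y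
    using power_mono[OF A(2), of y 2] lambda_max_pos[OF S] by (simp add: power_mult_distrib)
  have dominating: "integrable ?N (\<lambda>y. lambda_max S * (norm y)\<^sup>2)"
    by (intro integrable_mult_right integrable.intros[OF has_bochner_integral_std_normal_norm_power])
  then have integrable: "integrable ?N (\<lambda>y. (norm (A *v y))\<^sup>2)"
    by (rule Bochner_Integration.integrable_bound)
      (use order_trans[OF bound abs_ge_self] in \<open>auto simp: power2_eq_square[symmetric]\<close>)
  then show "integrable (normal_vec S) (\<lambda>x. (norm x)\<^sup>2)"
    unfolding A(1) by (subst integrable_distr_eq) simp_all
  have "(\<integral>x. (norm x)\<^sup>2 \<partial>normal_vec S) = (\<integral>y. (norm (A *v y))\<^sup>2 \<partial>?N)"
    unfolding A(1) by (subst integral_distr) simp_all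
  also have "\<dots> \<le> (\<integral>y. lambda_max S * (norm y)\<^sup>2 \<partial>?N)"
    by (rule integral_mono[OF integrable dominating bound])
  finally show "(\<integral>x. (norm x)\<^sup>2 \<partial>normal_vec S) \<le> lambda_max S * (\<integral>y. (norm y)\<^sup>2 \<partial>?N)" by simp
qed

lemma integrable_normal_vec_norm:
  assumes S: "pos_def_mat S"
  shows "integrable (normal_vec S) norm"
proof -
  interpret prob_space "normal_vec S" by (rule prob_space_normal_vec[OF S])
  show ?thesis
    by (rule square_integrable_imp_integrable[OF _ integral_normal_vec_norm_sq_le(1)[OF S]]) measurable
qed

subsection \<open>The constant as an inverse moment\<close>

lemma has_integral_I_fun:
  assumes "\<mu> > 0"
  shows "((\<lambda>r. exp (- r\<^sup>2 / 2) / (\<mu> + r)) has_integral I_fun \<mu>) {0..}"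
proof -
  have "(\<lambda>r. exp (- (r\<^sup>2) / 2) / (\<mu> + r)) integrable_on {0..}"
  proof (rule measurable_bounded_by_integrable_imp_integrable)
    show "(\<lambda>r. exp (- (r\<^sup>2) / 2) / (\<mu> + r)) \<in> borel_measurable (lebesgue_on {0..})"
      using assms by (intro continuous_imp_measurable_on_sets_lebesgue continuous_intros) auto
    show "(\<lambda>r. r ^ 0 * exp (- r\<^sup>2 / 2) / \<mu>) integrable_on {0..}"
      using has_integral_divide[OF has_integral_gaussian_moment[of 0]] by blast
    show "norm (exp (- (r\<^sup>2) / 2) / (\<mu> + r)) \<le> r ^ 0 * exp (- r\<^sup>2 / 2) / \<mu>" if "r \<in> {0..}" for r
      using that assms by (simp add: frac_le)
  qed simp
  then show ?thesis unfolding I_fun_def by (rule integrable_integral)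
qed

text \<open>Polynomial division of \<open>r ^ (p - 1)\<close> by \<open>\<mu> + r\<close>.\<close>
lemma alternating_power_sum_eq_quotient:
  fixes \<mu> r :: real
  assumes "\<mu> + r \<noteq> 0" "p \<ge> 2"
  shows "(\<Sum>j = 0..p - 2. (-1) ^ (p - j) * \<mu> ^ (p - 1 - j) * r ^ j) - (- \<mu>) ^ p / (\<mu> + r)
    = \<mu> * r ^ (p - 1) / (\<mu> + r)"
proof -
  obtain m where m: "p = Suc m" "m \<ge> 1" using assms(2) by (cases p) auto
  have "{0..p - 2} = {..<m}" using m by auto
  then have "(\<Sum>j = 0..p - 2. (-1) ^ (p - j) * \<mu> ^ (p - 1 - j) * r ^ j)
      = (\<Sum>j<m. \<mu> * ((- \<mu>) ^ (m - Suc j) * r ^ j))"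
  proof (rule sum.cong)
    fix j assume "j \<in> {..<m}"
    then obtain i where i: "m = Suc (j + i)" using less_imp_Suc_add by blast
    show "(-1) ^ (p - j) * \<mu> ^ (p - 1 - j) * r ^ j = \<mu> * ((- \<mu>) ^ (m - Suc j) * r ^ j)"
      by (simp add: m(1) i power_minus[of \<mu> i] Suc_diff_le)
  qed
  also have "\<dots> = \<mu> * (\<Sum>j<m. (- \<mu>) ^ (m - Suc j) * r ^ j)" by (simp add: sum_distrib_left)
  also have "(\<Sum>j<m. (- \<mu>) ^ (m - Suc j) * r ^ j) = (r ^ m - (- \<mu>) ^ m) / (\<mu> + r)"
    using power_diff_sumr2[of r m "- \<mu>"] assms(1) by (simp add: field_simps)
  finally show ?thesis using assms(1) by (simp add: m(1) field_simps)
qed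

lemma has_integral_gamma_const:
  assumes p: "p \<ge> 2" and d: "d > 0" and a: "a > 0"
  shows "((\<lambda>r. r ^ (p - 1) * exp (- r\<^sup>2 / 2) * (1 / (d + sqrt a * r))) has_integral
    gamma_const p d a * chi_const p) {0..}"
proof -
  define \<mu> where "\<mu> = d / sqrt a"
  define \<sigma> where "\<sigma> = (\<Sum>j = 0..p - 2. (-1) ^ (p - j) * \<mu> ^ (p - 1 - j) * chi_const (Suc j))
      - (- \<mu>) ^ p * I_fun \<mu>"
  define f where "f r = (\<Sum>j = 0..p - 2. (-1) ^ (p - j) * \<mu> ^ (p - 1 - j) * (r ^ j * exp (- r\<^sup>2 / 2)))
    - (- \<mu>) ^ p * (exp (- r\<^sup>2 / 2) / (\<mu> + r))" for r
  have \<mu>: "\<mu> > 0" using d a by (simp add: \<mu>_def)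
  have "(f has_integral \<sigma>) {0..}"
    unfolding f_def \<sigma>_def
    by (intro has_integral_diff has_integral_sum has_integral_mult_right
        has_integral_gaussian_moment has_integral_I_fun \<mu>) simp
  moreover have "gamma_const p d a = \<sigma> / (chi_const p * d)"
    by (simp add: gamma_const_def Let_def \<sigma>_def \<mu>_def chi_const_Suc chi_const_def[of p] mult_ac)
  then have "\<sigma> = gamma_const p d a * chi_const p * d"
    using d p chi_const_pos[of p] by simp
  ultimately have "((\<lambda>r. f r / d) has_integral gamma_const p d a * chi_const p) {0..}"
    using d by (auto dest: has_integral_divide[where c=d])
  then show ?thesis
  proof (rule has_integral_eq[rotated])
    fix r :: real assume "r \<in> {0..}"
    then have r: "\<mu> + r \<noteq> 0" using \<mu> by simp
    have "f r = ((\<Sum>j = 0..p - 2. (-1) ^ (p - j) * \<mu> ^ (p - 1 - j) * r ^ j) - (- \<mu>) ^ p / (\<mu> + r))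
        * exp (- r\<^sup>2 / 2)"
      by (simp add: f_def left_diff_distrib sum_distrib_right mult.assoc)
    also have "\<dots> = \<mu> * r ^ (p - 1) / (\<mu> + r) * exp (- r\<^sup>2 / 2)"
      by (simp only: alternating_power_sum_eq_quotient[OF r p])
    finally have "f r / d = r ^ (p - 1) * exp (- r\<^sup>2 / 2) * (\<mu> / (d * (\<mu> + r)))"
      by (simp add: mult_ac)
    also have "\<mu> / (d * (\<mu> + r)) = 1 / (d + sqrt a * r)"
    proof -
      have "d + sqrt a * r = sqrt a * (\<mu> + r)" "d = sqrt a * \<mu>"
        using a by (simp_all add: \<mu>_def field_simps)
      then show ?thesis using \<mu> by simp
    qed
    finally show "f r / d = r ^ (p - 1) * exp (- r\<^sup>2 / 2) * (1 / (d + sqrt a * r))" .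
  qed
qed

lemma has_bochner_integral_mono:
  fixes f g :: "'a \<Rightarrow> real"
  assumes "has_bochner_integral M f x" "has_bochner_integral M g y" "\<And>\<omega>. \<omega> \<in> space M \<Longrightarrow> f \<omega> \<le> g \<omega>"
  shows "x \<le> y"
  using assms integral_mono[of M f g] by (auto simp: has_bochner_integral_iff)

lemma has_bochner_integral_gamma_const:
  assumes p: "CARD('n) \<ge> 2" and d: "d > 0" and a: "a > 0"
  shows "has_bochner_integral (normal_vec (mat 1 :: real^'n^'n))
    (\<lambda>y. 1 / (d + sqrt a * norm y)) (gamma_const CARD('n) d a)"
proof -
  have "0 \<le> 1 / (d + sqrt a * r)" if "0 \<le> r" for r using that d a by simp
  then show ?thesis
    using has_bochner_integral_std_normal_radial[OF _ _ has_integral_gamma_const[OF p d a]]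
      chi_const_pos[of "CARD('n)"]
    by simp
qed

lemma gamma_const_eq_integral:
  assumes "CARD('n) \<ge> 2" "d > 0" "a > 0"
  shows "gamma_const CARD('n) d a = (\<integral>y. 1 / (d + sqrt a * norm y) \<partial>normal_vec (mat 1 :: real^'n^'n))"
  using has_bochner_integral_gamma_const[OF assms] by (simp add: has_bochner_integral_iff)

lemma gamma_const_nonneg:
  assumes "CARD('n) \<ge> 2" "d > 0" "a > 0"
  shows "0 \<le> gamma_const CARD('n::finite) d a"
  unfolding gamma_const_eq_integral[OF assms] using assms
  by (intro Bochner_Integration.integral_nonneg) simp

lemma gamma_const_le_inverse:
  assumes p: "CARD('n) \<ge> 2" and d: "d > 0" and a: "a > 0"
  shows "gamma_const CARD('n::finite) d a \<le> 1 / d"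
proof -
  interpret prob_space "normal_vec (mat 1 :: real^'n^'n)" by (rule prob_space_normal_vec_std)
  show ?thesis
    unfolding gamma_const_eq_integral[OF p d a]
    using d a has_bochner_integral_gamma_const[OF p d a]
    by (intro integral_le_const) (auto simp: has_bochner_integral_iff frac_le)
qed

lemma gamma_const_antimono:
  assumes p: "CARD('n) \<ge> 2" and d: "d > 0" and a: "0 < a" "a \<le> b"
  shows "gamma_const CARD('n::finite) d b \<le> gamma_const CARD('n) d a"
proof (rule has_bochner_integral_mono[OF has_bochner_integral_gamma_const has_bochner_integral_gamma_const])
  show "1 / (d + sqrt b * norm y) \<le> 1 / (d + sqrt a * norm y)" for y :: "real^'n"
    using d a by (intro frac_le add_mono mult_right_mono) (auto simp: add_pos_nonneg)
qed (use assms in auto)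

lemma convex_on_inverse_affine_sqrt:
  fixes d r :: real
  assumes d: "d > 0" and r: "r \<ge> 0"
  shows "convex_on {0<..} (\<lambda>a. 1 / (d + sqrt a * r))"
proof (rule convex_on_realI)
  define f' where "f' a = - (r / (2 * sqrt a * (d + sqrt a * r)\<^sup>2))" for a
  have pos: "d + sqrt a * r > 0" if "a > 0" for a using that d r by (simp add: add_pos_nonneg)
  show "((\<lambda>a. 1 / (d + sqrt a * r)) has_real_derivative f' a) (at a)" if "a \<in> {0<..}" for a
    using that pos[of a] less_imp_neq[OF pos[of a]]
    by (auto intro!: derivative_eq_intros simp: f'_def field_simps power2_eq_square)
  show "f' a \<le> f' b" if "a \<in> {0<..}" "b \<in> {0<..}" "a \<le> b" for a b
    using that d r pos[of a] pos[of b] unfolding f'_def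
    by (intro le_imp_neg_le divide_left_mono mult_mono power_mono add_mono mult_pos_pos) auto
qed auto

lemma convex_on_gamma_const:
  assumes p: "CARD('n) \<ge> 2" and d: "d > 0"
  shows "convex_on {0<..} (gamma_const CARD('n::finite) d)"
proof (rule convex_onI)
  fix t a b :: real
  assume t: "0 < t" "t < 1" and ab: "a \<in> {0<..}" "b \<in> {0<..}"
  note bochner = has_bochner_integral_gamma_const[OF p d]
  show "gamma_const CARD('n) d ((1 - t) *\<^sub>R a + t *\<^sub>R b)
      \<le> (1 - t) * gamma_const CARD('n) d a + t * gamma_const CARD('n) d b"
  proof (rule has_bochner_integral_mono)
    show "has_bochner_integral (normal_vec (mat 1 :: real^'n^'n))
        (\<lambda>y. 1 / (d + sqrt ((1 - t) *\<^sub>R a + t *\<^sub>R b) * norm y))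
        (gamma_const CARD('n) d ((1 - t) *\<^sub>R a + t *\<^sub>R b))"
      using t ab by (intro bochner) (simp add: add_pos_pos)
    show "has_bochner_integral (normal_vec (mat 1 :: real^'n^'n))
        (\<lambda>y. (1 - t) * (1 / (d + sqrt a * norm y)) + t * (1 / (d + sqrt b * norm y)))
        ((1 - t) * gamma_const CARD('n) d a + t * gamma_const CARD('n) d b)"
      using ab by (intro has_bochner_integral_add has_bochner_integral_mult_right bochner) auto
    show "1 / (d + sqrt ((1 - t) *\<^sub>R a + t *\<^sub>R b) * norm y)
        \<le> (1 - t) * (1 / (d + sqrt a * norm y)) + t * (1 / (d + sqrt b * norm y))" for y :: "real^'n"
      using convex_onD[OF convex_on_inverse_affine_sqrt[OF d norm_ge_zero[of y]], of t a b] t ab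
      by auto
  qed
qed simp

lemma borel_measurable_gamma_const:
  assumes p: "CARD('n) \<ge> 2" and d: "d > 0"
    and X: "X \<in> borel_measurable M" "\<And>\<omega>. \<omega> \<in> space M \<Longrightarrow> 0 < X \<omega>"
  shows "(\<lambda>\<omega>. gamma_const CARD('n::finite) d (X \<omega>)) \<in> borel_measurable M"
proof -
  have "X \<in> M \<rightarrow>\<^sub>M restrict_space borel {0<..}"
    using X by (intro measurable_restrict_space2) auto
  moreover have "continuous_on {0<..} (gamma_const CARD('n) d)"
    by (intro convex_on_continuous convex_on_gamma_const p d) simp
  then have "gamma_const CARD('n) d \<in> borel_measurable (restrict_space borel {0<..})"
    by (rule borel_measurable_continuous_on_restrict)
  ultimately show ?thesis by (rule measurable_compose)
qed

lemma (in prob_space) gamma_const_le_expectation: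
  assumes p: "CARD('n) \<ge> 2" and d: "d > 0"
    and X: "integrable M X" "\<And>\<omega>. \<omega> \<in> space M \<Longrightarrow> 0 < X \<omega>" and a: "expectation X \<le> a"
  shows "integrable M (\<lambda>\<omega>. gamma_const CARD('n::finite) d (X \<omega>))"
    and "gamma_const CARD('n) d a \<le> expectation (\<lambda>\<omega>. gamma_const CARD('n) d (X \<omega>))"
proof -
  let ?\<gamma> = "gamma_const CARD('n) d"
  show \<gamma>: "integrable M (\<lambda>\<omega>. ?\<gamma> (X \<omega>))"
    using gamma_const_nonneg[OF p d] gamma_const_le_inverse[OF p d] X
    by (intro integrable_const_bound[of _ "1 / d"] borel_measurable_gamma_const[OF p d]) auto
  have "0 < expectation X"
    using integral_less_AE_space[of "\<lambda>_. 0" X] X by (simp add: emeasure_space_1)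
  then have "?\<gamma> a \<le> ?\<gamma> (expectation X)"
    using a by (intro gamma_const_antimono p d) auto
  also have "\<dots> \<le> expectation (\<lambda>\<omega>. ?\<gamma> (X \<omega>))"
    using X by (intro jensens_inequality[where I="{0<..}" and a=0] convex_on_gamma_const p d \<gamma>) auto
  finally show "?\<gamma> a \<le> expectation (\<lambda>\<omega>. ?\<gamma> (X \<omega>))" .
qed

subsection \<open>Stein's identity\<close>

lemma integrable_lborel_translate_iff:
  fixes f :: "'a::euclidean_space \<Rightarrow> real"
  assumes [measurable]: "f \<in> borel_measurable borel"
  shows "integrable lborel (\<lambda>x. f (x + t)) \<longleftrightarrow> integrable lborel f"
  by (subst (2) lborel_distr_plus[of t, symmetric]) (simp add: integrable_distr_eq add.commute)

lemma integral_lborel_translate: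
  fixes f :: "'a::euclidean_space \<Rightarrow> real"
  assumes [measurable]: "f \<in> borel_measurable borel"
  shows "(\<integral>x. f (x + t) \<partial>lborel) = (\<integral>x. f x \<partial>lborel)"
  by (subst (2) lborel_distr_plus[of t, symmetric]) (simp add: integral_distr add.commute)

lemma lborel_integral_derivative_Icc:
  fixes f f' :: "real \<Rightarrow> real"
  assumes "a \<le> b" and f: "\<And>t. (f has_real_derivative f' t) (at t)"
    and "integrable lborel (\<lambda>t. indicator {a..b} t * f' t)"
  shows "(\<integral>t. indicator {a..b} t * f' t \<partial>lborel) = f b - f a"
proof -
  have "(f' has_integral (f b - f a)) {a..b}"
    using f by (intro fundamental_theorem_of_calculus assms(1))
      (simp add: has_real_derivative_iff_has_vector_derivative has_vector_derivative_at_within)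
  then have "((\<lambda>t. indicator {a..b} t * f' t) has_integral (f b - f a)) UNIV"
    by (subst (asm) has_integral_restrict_UNIV[symmetric])
      (simp add: indicator_def of_bool_def if_distrib[of "\<lambda>c. c * _"] cong: if_cong)
  with has_integral_integral_lborel[OF assms(3)] show ?thesis by (rule has_integral_unique)
qed

text \<open>Integrating the derivative over a unit time step along the flow \<open>x \<mapsto> x + t *\<^sub>R v\<close>, which
  preserves Lebesgue measure, yields the integral of \<open>F (x + v) - F x\<close>.\<close>
lemma integral_directional_derivative_eq_0:
  fixes F F' :: "'a::euclidean_space \<Rightarrow> real"
  assumes F: "integrable lborel F" and F': "integrable lborel F'"
    and deriv: "\<And>x. ((\<lambda>t. F (x + t *\<^sub>R v)) has_real_derivative F' x) (at 0)"
  shows "(\<integral>x. F' x \<partial>lborel) = 0"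
proof -
  let ?K = "\<lambda>t x. indicator {0..1} t * F' (x + t *\<^sub>R v)"
  have [measurable]: "F \<in> borel_measurable borel" "F' \<in> borel_measurable borel"
    using F F' by (auto dest: borel_measurable_integrable)
  have F'_translate: "integrable lborel (\<lambda>x. F' (x + t *\<^sub>R v))" for t
    by (simp add: integrable_lborel_translate_iff F')
  have K: "integrable (lborel \<Otimes>\<^sub>M lborel) (case_prod ?K)"
  proof (rule lborel_pair.Fubini_integrable)
    have "(\<lambda>t. \<integral>x. norm (case (t, x) of (t, x) \<Rightarrow> ?K t x) \<partial>lborel)
        = (\<lambda>t. indicator {0..1} t * (\<integral>x. \<bar>F' x\<bar> \<partial>lborel))"
      by (simp add: abs_mult integral_lborel_translate[of "\<lambda>x. \<bar>F' x\<bar>"])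
    then show "integrable lborel (\<lambda>t. \<integral>x. norm (case (t, x) of (t, x) \<Rightarrow> ?K t x) \<partial>lborel)" by simp
    show "AE t in lborel. integrable lborel (\<lambda>x. case (t, x) of (t, x) \<Rightarrow> ?K t x)"
      by (simp add: F'_translate)
  qed measurable
  have flow_deriv: "((\<lambda>t. F (x + t *\<^sub>R v)) has_real_derivative F' (x + t *\<^sub>R v)) (at t)" for x t
    using deriv[of "x + t *\<^sub>R v"] DERIV_shift[of "\<lambda>t. F (x + t *\<^sub>R v)" _ 0 t]
    by (simp add: algebra_simps)
  have "(\<integral>x. F' x \<partial>lborel) = (\<integral>t. (\<integral>x. ?K t x \<partial>lborel) \<partial>lborel)"
    by (simp add: integral_lborel_translate)
  also have "\<dots> = (\<integral>x. (\<integral>t. ?K t x \<partial>lborel) \<partial>lborel)"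
    using lborel_pair.Fubini_integral[OF K] by simp
  also have "\<dots> = (\<integral>x. F (x + v) - F x \<partial>lborel)"
  proof (rule integral_cong_AE)
    show "AE x in lborel. (\<integral>t. ?K t x \<partial>lborel) = F (x + v) - F x"
      using lborel_pair.AE_integrable_snd[OF K] lborel_integral_derivative_Icc[OF zero_le_one flow_deriv]
      by auto
  qed measurable
  also have "\<dots> = 0"
    using F by (simp add: integral_lborel_translate integrable_lborel_translate_iff)
  finally show ?thesis .
qed

lemma has_real_derivative_mvn_density:
  fixes S :: "real^'n^'n"
  assumes S: "pos_def_mat S"
  shows "((\<lambda>t. mvn_density S (x + t *\<^sub>R (S *v a))) has_real_derivative - (a \<bullet> x) * mvn_density S x) (at 0)"
proof -
  let ?M = "matrix_inv S" and ?v = "S *v a"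
  note cancel = matrix_inv_cancel[OF pos_def_mat_invertible[OF S]]
  have "?v \<bullet> (?M *v x) = a \<bullet> x"
    by (simp add: symmetric_matrix_selfadjoint[OF pos_def_mat_symmetric[OF S]] cancel)
  then have "(x + t *\<^sub>R ?v) \<bullet> (?M *v (x + t *\<^sub>R ?v))
      = x \<bullet> (?M *v x) + 2 * t * (a \<bullet> x) + t\<^sup>2 * (a \<bullet> ?v)" for t
    by (simp add: matrix_vector_right_distrib matrix_vector_mult_scaleR cancel inner_add
        inner_commute[of x a] inner_commute[of ?v a] algebra_simps power2_eq_square)
  then have "mvn_density S (x + t *\<^sub>R ?v)
      = mvn_density S x * exp (- (t * (a \<bullet> x)) - t\<^sup>2 * (a \<bullet> ?v) / 2)" for t
    by (simp add: mvn_density_def exp_add[symmetric] field_simps)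
  then show ?thesis by (auto intro!: derivative_eq_intros)
qed

lemma stein_identity_direction:
  fixes S :: "real^'n^'n" and k k' :: "real^'n \<Rightarrow> real"
  assumes S: "pos_def_mat S"
    and k: "integrable (normal_vec S) k" and k': "integrable (normal_vec S) k'"
    and ka: "integrable (normal_vec S) (\<lambda>x. k x * (a \<bullet> x))"
    and deriv: "\<And>x. ((\<lambda>t. k (x + t *\<^sub>R (S *v a))) has_real_derivative k' x) (at 0)"
  shows "(\<integral>x. k' x \<partial>normal_vec S) = (\<integral>x. k x * (a \<bullet> x) \<partial>normal_vec S)"
proof -
  let ?\<phi> = "mvn_density S"
  have [measurable]: "k \<in> borel_measurable borel" "k' \<in> borel_measurable borel"
    using k k' by (auto dest: borel_measurable_integrable)
  have lborel: "integrable lborel (\<lambda>x. ?\<phi> x * k x)" "integrable lborel (\<lambda>x. ?\<phi> x * k' x)"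
    "integrable lborel (\<lambda>x. ?\<phi> x * (k x * (a \<bullet> x)))"
    using k k' ka by (simp_all add: integral_normal_vec(1)[OF S])
  have "(\<integral>x. ?\<phi> x * k' x - ?\<phi> x * (k x * (a \<bullet> x)) \<partial>lborel) = 0"
  proof (rule integral_directional_derivative_eq_0)
    show "((\<lambda>t. ?\<phi> (x + t *\<^sub>R (S *v a)) * k (x + t *\<^sub>R (S *v a))) has_real_derivative
        ?\<phi> x * k' x - ?\<phi> x * (k x * (a \<bullet> x))) (at 0)" for x
      using DERIV_mult[OF has_real_derivative_mvn_density[OF S] deriv, of x a]
      by (simp add: algebra_simps)
  qed (use lborel in auto)
  then show ?thesis using lborel by (simp add: integral_normal_vec(2)[OF S])
qed

text \<open>The integrand on the left is the trace of the Jacobian of \<open>f\<close> times \<open>S\<close>.\<close>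
lemma stein_identity:
  fixes S :: "real^'n^'n" and f :: "real^'n \<Rightarrow> real^'n"
  assumes S: "pos_def_mat S"
    and f: "\<And>i. integrable (normal_vec S) (\<lambda>x. f x $ i)"
    and fx: "\<And>i. integrable (normal_vec S) (\<lambda>x. f x $ i * x $ i)"
    and f': "\<And>i. integrable (normal_vec S) (\<lambda>x. f' x (column i S) $ i)"
    and deriv: "\<And>x. (f has_derivative f' x) (at x)"
  shows "(\<integral>x. (\<Sum>i\<in>UNIV. f' x (column i S) $ i) \<partial>normal_vec S) = (\<integral>x. x \<bullet> f x \<partial>normal_vec S)"
proof -
  have component: "(\<integral>x. f' x (column i S) $ i \<partial>normal_vec S) = (\<integral>x. f x $ i * x $ i \<partial>normal_vec S)" for i
  proof -
    have "((\<lambda>t. f (x + t *\<^sub>R column i S)) has_vector_derivative f' x (column i S)) (at 0)" for x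
    proof -
      have "((\<lambda>t. x + t *\<^sub>R column i S) has_vector_derivative column i S) (at 0)"
        by (auto intro!: derivative_eq_intros)
      then show ?thesis
        using vector_derivative_diff_chain_within[of "\<lambda>t. x + t *\<^sub>R column i S" _ 0 UNIV f "f' x"]
          deriv[of x]
        by (auto simp: comp_def intro: has_derivative_at_withinI)
    qed
    then have "((\<lambda>t. f (x + t *\<^sub>R (S *v axis i 1)) $ i)
        has_real_derivative f' x (column i S) $ i) (at 0)" for x
      by (auto simp: has_real_derivative_iff_has_vector_derivative matrix_vector_mult_basis
          intro: bounded_linear.has_vector_derivative[OF bounded_linear_vec_nth])
    then have "(\<integral>x. f' x (column i S) $ i \<partial>normal_vec S) = (\<integral>x. f x $ i * (axis i 1 \<bullet> x) \<partial>normal_vec S)"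
      using fx[of i] by (intro stein_identity_direction[OF S f f']) (simp_all add: inner_axis')
    then show ?thesis by (simp add: inner_axis')
  qed
  have "(\<integral>x. (\<Sum>i\<in>UNIV. f' x (column i S) $ i) \<partial>normal_vec S)
      = (\<Sum>i\<in>UNIV. \<integral>x. f x $ i * x $ i \<partial>normal_vec S)"
    unfolding component[symmetric] by (rule Bochner_Integration.integral_sum[OF f'])
  also have "\<dots> = (\<integral>x. (\<Sum>i\<in>UNIV. f x $ i * x $ i) \<partial>normal_vec S)"
    by (rule Bochner_Integration.integral_sum[OF fx, symmetric])
  finally show ?thesis by (simp add: inner_vec_def mult.commute)
qed

subsection \<open>The mean radial component of the noise\<close>

definition smoothed_norm :: "real \<Rightarrow> 'a::real_inner \<Rightarrow> real" where
  "smoothed_norm e z = sqrt (z \<bullet> z + e\<^sup>2)"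

lemma norm_le_smoothed_norm: "norm z \<le> smoothed_norm e z"
  unfolding smoothed_norm_def by (rule real_le_rsqrt) (simp add: power2_norm_eq_inner)

lemma le_smoothed_norm: "e \<le> smoothed_norm e z"
  unfolding smoothed_norm_def by (rule real_le_rsqrt) simp

lemma smoothed_norm_le: "0 \<le> e \<Longrightarrow> smoothed_norm e z \<le> norm z + e"
  unfolding smoothed_norm_def by (rule real_le_lsqrt) (auto simp: power2_sum dot_square_norm)

lemma smoothed_norm_pos: "0 < e \<Longrightarrow> 0 < smoothed_norm e z"
  using le_smoothed_norm[of e z] by linarith

lemma smoothed_norm_power2: "(smoothed_norm e z)\<^sup>2 = z \<bullet> z + e\<^sup>2"
  by (simp add: smoothed_norm_def)

lemma borel_measurable_smoothed_norm [measurable]: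
  "smoothed_norm e \<in> borel_measurable (borel :: 'a::euclidean_space measure)"
  unfolding smoothed_norm_def by measurable

lemma tendsto_smoothed_norm: "(e \<longlongrightarrow> 0) F \<Longrightarrow> ((\<lambda>n. smoothed_norm (e n) z) \<longlongrightarrow> norm z) F"
  unfolding smoothed_norm_def by (auto intro!: tendsto_eq_intros simp: norm_eq_sqrt_inner)

definition smoothed_direction :: "real \<Rightarrow> 'a::real_inner \<Rightarrow> 'a" where
  "smoothed_direction e z = z /\<^sub>R smoothed_norm e z"

definition smoothed_direction_deriv :: "real \<Rightarrow> 'a::real_inner \<Rightarrow> 'a \<Rightarrow> 'a" where
  "smoothed_direction_deriv e z h = h /\<^sub>R smoothed_norm e z - ((z \<bullet> h) / smoothed_norm e z ^ 3) *\<^sub>R z"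

lemma norm_smoothed_direction_le: "norm (smoothed_direction e z) \<le> 1"
proof -
  have nonneg: "0 \<le> smoothed_norm e z" by (simp add: smoothed_norm_def)
  then have "norm (smoothed_direction e z) = norm z / smoothed_norm e z"
    by (simp add: smoothed_direction_def divide_inverse_commute)
  also have "\<dots> \<le> 1"
    using nonneg norm_le_smoothed_norm[of z e] by (intro divide_le_eq_1[THEN iffD2]) linarith
  finally show ?thesis .
qed

lemma tendsto_smoothed_direction:
  assumes "(e \<longlongrightarrow> 0) F"
  shows "((\<lambda>n. smoothed_direction (e n) z) \<longlongrightarrow> sgn z) F"
proof (cases "z = 0")
  case False
  then show ?thesis
    unfolding smoothed_direction_def sgn_div_norm
    by (intro tendsto_intros tendsto_smoothed_norm assms) simp
qed (simp add: smoothed_direction_def)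

lemma borel_measurable_smoothed_direction [measurable]:
  "smoothed_direction e \<in> borel_measurable (borel :: 'a::euclidean_space measure)"
  unfolding smoothed_direction_def by measurable

lemma borel_measurable_smoothed_direction_deriv [measurable]:
  "(\<lambda>z. smoothed_direction_deriv e z h) \<in> borel_measurable (borel :: 'a::euclidean_space measure)"
  unfolding smoothed_direction_deriv_def by measurable

lemma has_derivative_smoothed_direction:
  assumes e: "0 < e"
  shows "(smoothed_direction e has_derivative smoothed_direction_deriv e z) (at z)"
proof -
  let ?\<rho> = "smoothed_norm e"
  have "0 < z \<bullet> z + e\<^sup>2" using e by (simp add: add_nonneg_pos)
  then have "(?\<rho> has_derivative (\<lambda>h. (z \<bullet> h) / ?\<rho> z)) (at z)"
    unfolding smoothed_norm_def[abs_def]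
    by (auto intro!: derivative_eq_intros simp: inner_commute field_simps)
  moreover have "?\<rho> z \<noteq> 0" using smoothed_norm_pos[OF e, of z] by simp
  ultimately show ?thesis
    unfolding smoothed_direction_def[abs_def] smoothed_direction_deriv_def[abs_def]
    by (auto intro!: derivative_eq_intros simp: field_simps power3_eq_cube power2_eq_square)
qed

lemma norm_smoothed_direction_deriv_le:
  assumes e: "0 < e"
  shows "norm (smoothed_direction_deriv e z h) \<le> 2 * norm h / e"
proof -
  let ?\<rho> = "smoothed_norm e z"
  have pos: "0 < ?\<rho>" by (rule smoothed_norm_pos[OF e])
  have "\<bar>z \<bullet> h\<bar> * norm z \<le> (norm z * norm h) * norm z"
    by (intro mult_right_mono Cauchy_Schwarz_ineq2) simp
  also have "\<dots> = (norm z)\<^sup>2 * norm h" by (simp add: power2_eq_square)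
  also have "\<dots> \<le> ?\<rho>\<^sup>2 * norm h" by (intro mult_right_mono power_mono norm_le_smoothed_norm) auto
  finally have "norm (((z \<bullet> h) / ?\<rho> ^ 3) *\<^sub>R z) \<le> norm h / ?\<rho>"
    using pos by (simp add: field_simps power2_eq_square power3_eq_cube)
  moreover have "norm (h /\<^sub>R ?\<rho>) = norm h / ?\<rho>" using pos by (simp add: divide_inverse mult.commute)
  moreover have "norm h / ?\<rho> \<le> norm h / e"
    using le_smoothed_norm[of e z] e by (intro divide_left_mono) auto
  ultimately show ?thesis
    unfolding smoothed_direction_deriv_def
    using norm_triangle_ineq4[of "h /\<^sub>R ?\<rho>" "((z \<bullet> h) / ?\<rho> ^ 3) *\<^sub>R z"] by linarith
qed

lemma trace_smoothed_direction_deriv_ge: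
  fixes S :: "real^'n^'n"
  assumes S: "pos_def_mat S" and e: "0 < e"
  shows "(real CARD('n) - 1) * lambda_min S / smoothed_norm e z
    \<le> (\<Sum>i\<in>UNIV. smoothed_direction_deriv e z (column i S) $ i)"
proof -
  note sym = pos_def_mat_symmetric[OF S]
  let ?r = "smoothed_norm e z"
  have r: "0 < ?r" by (rule smoothed_norm_pos[OF e])
  have "z \<bullet> column i S = (S *v z) $ i" for i
    using symmetric_matrix_selfadjoint[OF sym, of z "axis i 1"]
    by (simp add: matrix_vector_mult_basis inner_axis)
  then have component: "smoothed_direction_deriv e z (column i S) $ i
      = S $ i $ i / ?r - (z $ i * (S *v z) $ i) / ?r ^ 3" for i
    by (simp add: smoothed_direction_deriv_def column_def divide_inverse_commute mult_ac)
  have "(real CARD('n) - 1) * lambda_min S / ?r = (real CARD('n) - 1) * lambda_min S * ?r\<^sup>2 / ?r ^ 3"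
    using r by (simp add: power2_eq_square power3_eq_cube)
  also have "\<dots> \<le> (trace S * ?r\<^sup>2 - z \<bullet> (S *v z)) / ?r ^ 3"
    using r lambda_min_pos[OF S]
    by (intro divide_right_mono trace_minus_rayleigh_ge sym) (auto simp: smoothed_norm_power2)
  also have "\<dots> = trace S / ?r - (z \<bullet> (S *v z)) / ?r ^ 3"
    using r by (simp add: field_simps power2_eq_square power3_eq_cube)
  also have "\<dots> = (\<Sum>i\<in>UNIV. smoothed_direction_deriv e z (column i S) $ i)"
    by (simp add: component trace_def inner_vec_def sum_subtractf sum_divide_distrib)
  finally show ?thesis .
qed

lemma abs_inner_le_norm: "norm u \<le> 1 \<Longrightarrow> \<bar>x \<bullet> u\<bar> \<le> norm x" for x u :: "'a::real_inner"
  using Cauchy_Schwarz_ineq2[of x u] mult_left_mono[of "norm u" 1 "norm x"] by simp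

lemma stein_smoothed_direction:
  fixes S :: "real^'n^'n"
  assumes S: "pos_def_mat S" and e: "0 < e"
  shows "integrable (normal_vec S) (\<lambda>x. \<Sum>i\<in>UNIV. smoothed_direction_deriv e (\<theta> + x) (column i S) $ i)"
    and "(\<integral>x. (\<Sum>i\<in>UNIV. smoothed_direction_deriv e (\<theta> + x) (column i S) $ i) \<partial>normal_vec S)
      = (\<integral>x. x \<bullet> smoothed_direction e (\<theta> + x) \<partial>normal_vec S)"
proof -
  interpret prob_space "normal_vec S" by (rule prob_space_normal_vec[OF S])
  let ?f = "\<lambda>x. smoothed_direction e (\<theta> + x)" and ?f' = "\<lambda>x. smoothed_direction_deriv e (\<theta> + x)"
  have f: "\<bar>?f x $ i\<bar> \<le> 1" for x i
    by (rule order_trans[OF component_le_norm_cart norm_smoothed_direction_le])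
  then have int_f: "integrable (normal_vec S) (\<lambda>x. ?f x $ i)" for i
    by (intro integrable_const_bound[of _ 1]) auto
  have int_fx: "integrable (normal_vec S) (\<lambda>x. ?f x $ i * x $ i)" for i
  proof (rule Bochner_Integration.integrable_bound[OF integrable_normal_vec_norm[OF S]])
    have "\<bar>?f x $ i\<bar> * \<bar>x $ i\<bar> \<le> 1 * norm x" for x
      by (intro mult_mono component_le_norm_cart f) auto
    then show "AE x in normal_vec S. norm (?f x $ i * x $ i) \<le> norm (norm x)" by (simp add: abs_mult)
  qed measurable
  have int_f': "integrable (normal_vec S) (\<lambda>x. ?f' x (column i S) $ i)" for i
    using order_trans[OF component_le_norm_cart norm_smoothed_direction_deriv_le[OF e]]
    by (intro integrable_const_bound[of _ "2 * norm (column i S) / e"]) auto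
  then show "integrable (normal_vec S) (\<lambda>x. \<Sum>i\<in>UNIV. ?f' x (column i S) $ i)"
    by (rule Bochner_Integration.integrable_sum)
  have "(?f has_derivative ?f' x) (at x)" for x
    by (rule has_derivative_compose[OF _ has_derivative_smoothed_direction[OF e], of "\<lambda>x. \<theta> + x" "\<lambda>h. h"])
      (auto intro!: derivative_eq_intros)
  then show "(\<integral>x. (\<Sum>i\<in>UNIV. ?f' x (column i S) $ i) \<partial>normal_vec S) = (\<integral>x. x \<bullet> ?f x \<partial>normal_vec S)"
    by (rule stein_identity[OF S int_f int_fx int_f'])
qed

lemma integral_smoothed_radial_component_ge:
  fixes S :: "real^'n^'n"
  assumes S: "pos_def_mat S" and e: "0 < e" and d: "norm \<theta> \<le> d" "0 < d"
  shows "(real CARD('n) - 1) * lambda_min S * (\<integral>x. 1 / (d + e + norm x) \<partial>normal_vec S)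
    \<le> (\<integral>x. x \<bullet> smoothed_direction e (\<theta> + x) \<partial>normal_vec S)"
proof -
  let ?c = "(real CARD('n) - 1) * lambda_min S"
  let ?div = "\<lambda>x. \<Sum>i\<in>UNIV. smoothed_direction_deriv e (\<theta> + x) (column i S) $ i"
  interpret prob_space "normal_vec S" by (rule prob_space_normal_vec[OF S])
  have "1 \<le> real CARD('n)" by (simp add: Suc_le_eq)
  then have c: "0 \<le> ?c" using lambda_min_pos[OF S] by simp
  have pos: "0 < d + e + norm x" for x :: "real^'n" using d e by (simp add: add_pos_nonneg)
  have "?c * (\<integral>x. 1 / (d + e + norm x) \<partial>normal_vec S) = (\<integral>x. ?c * (1 / (d + e + norm x)) \<partial>normal_vec S)"
    by (rule integral_mult_right_zero[symmetric])
  also have "\<dots> \<le> (\<integral>x. ?div x \<partial>normal_vec S)"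
  proof (rule integral_mono)
    show "integrable (normal_vec S) (\<lambda>x. ?c * (1 / (d + e + norm x)))"
      using d e pos by (intro integrable_mult_right integrable_const_bound[of _ "1 / d"] AE_I2)
        (auto simp: abs_of_pos intro!: frac_le)
    fix x
    have "smoothed_norm e (\<theta> + x) \<le> d + e + norm x"
      using smoothed_norm_le[of e "\<theta> + x"] e d norm_triangle_ineq[of \<theta> x] by linarith
    then have "?c * (1 / (d + e + norm x)) \<le> ?c * (1 / smoothed_norm e (\<theta> + x))"
      using smoothed_norm_pos[OF e] pos c by (intro mult_left_mono frac_le) simp_all
    also have "\<dots> \<le> ?div x" using trace_smoothed_direction_deriv_ge[OF S e] by simp
    finally show "?c * (1 / (d + e + norm x)) \<le> ?div x" .
  qed (rule stein_smoothed_direction(1)[OF S e])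
  also have "\<dots> = (\<integral>x. x \<bullet> smoothed_direction e (\<theta> + x) \<partial>normal_vec S)"
    by (rule stein_smoothed_direction(2)[OF S e])
  finally show ?thesis .
qed

lemma integral_radial_component_ge:
  fixes S :: "real^'n^'n"
  assumes S: "pos_def_mat S" and d: "norm \<theta> \<le> d" "0 < d"
  shows "(real CARD('n) - 1) * lambda_min S * (\<integral>x. 1 / (d + norm x) \<partial>normal_vec S)
    \<le> (\<integral>x. x \<bullet> sgn (\<theta> + x) \<partial>normal_vec S)"
proof (rule LIMSEQ_le)
  let ?c = "(real CARD('n) - 1) * lambda_min S"
  interpret prob_space "normal_vec S" by (rule prob_space_normal_vec[OF S])
  define e where "e n = inverse (real (Suc n))" for n
  have e: "0 < e n" for n by (simp add: e_def)
  have e_lim: "e \<longlonglongrightarrow> 0" unfolding e_def[abs_def] by (rule LIMSEQ_inverse_real_of_nat)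
  have "(\<lambda>n. \<integral>x. 1 / (d + e n + norm x) \<partial>normal_vec S) \<longlonglongrightarrow> (\<integral>x. 1 / (d + 0 + norm x) \<partial>normal_vec S)"
  proof (rule integral_dominated_convergence[where w="\<lambda>_. 1 / d"])
    show "AE x in normal_vec S. (\<lambda>n. 1 / (d + e n + norm x)) \<longlonglongrightarrow> 1 / (d + 0 + norm x)"
      using d
      by (intro AE_I2 tendsto_intros e_lim) (simp add: add_pos_nonneg less_imp_neq[THEN not_sym])
    show "AE x in normal_vec S. norm (1 / (d + e n + norm x)) \<le> 1 / d" for n
      using d e[of n] by (intro AE_I2) (simp add: abs_of_pos add_pos_nonneg frac_le)
  qed auto
  then show "(\<lambda>n. ?c * (\<integral>x. 1 / (d + e n + norm x) \<partial>normal_vec S))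
      \<longlonglongrightarrow> ?c * (\<integral>x. 1 / (d + norm x) \<partial>normal_vec S)"
    by (simp add: tendsto_mult_left)
  show "(\<lambda>n. \<integral>x. x \<bullet> smoothed_direction (e n) (\<theta> + x) \<partial>normal_vec S)
      \<longlonglongrightarrow> (\<integral>x. x \<bullet> sgn (\<theta> + x) \<partial>normal_vec S)"
  proof (rule integral_dominated_convergence[where w=norm])
    show "integrable (normal_vec S) norm" by (rule integrable_normal_vec_norm[OF S])
    show "AE x in normal_vec S. (\<lambda>n. x \<bullet> smoothed_direction (e n) (\<theta> + x)) \<longlonglongrightarrow> x \<bullet> sgn (\<theta> + x)"
      by (intro AE_I2 tendsto_intros tendsto_smoothed_direction e_lim)
    show "AE x in normal_vec S. norm (x \<bullet> smoothed_direction (e n) (\<theta> + x)) \<le> norm x" for n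
      by (simp add: abs_inner_le_norm norm_smoothed_direction_le)
  qed measurable
  show "\<exists>N. \<forall>n\<ge>N. ?c * (\<integral>x. 1 / (d + e n + norm x) \<partial>normal_vec S)
      \<le> (\<integral>x. x \<bullet> smoothed_direction (e n) (\<theta> + x) \<partial>normal_vec S)"
    using integral_smoothed_radial_component_ge[OF S e d] by blast
qed

lemma gamma_const_lambda_max_le_integral:
  fixes S :: "real^'n^'n"
  assumes p: "CARD('n) \<ge> 2" and S: "pos_def_mat S" and d: "0 < d"
  shows "gamma_const CARD('n) d (lambda_max S) \<le> (\<integral>x. 1 / (d + norm x) \<partial>normal_vec S)"
proof -
  let ?N = "normal_vec (mat 1 :: real^'n^'n)"
  interpret prob_space ?N by (rule prob_space_normal_vec_std)
  obtain A :: "real^'n^'n" where A: "normal_vec S = distr ?N borel ((*v) A)"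
    "\<And>y. norm (A *v y) \<le> sqrt (lambda_max S) * norm y"
    using normal_vec_std_image[OF S] by blast
  have "has_bochner_integral ?N (\<lambda>y. 1 / (d + norm (A *v y))) (\<integral>y. 1 / (d + norm (A *v y)) \<partial>?N)"
    using d by (intro has_bochner_integral_integrable integrable_const_bound[of _ "1 / d"])
      (auto simp: abs_of_pos add_pos_nonneg intro!: frac_le)
  then have "gamma_const CARD('n) d (lambda_max S) \<le> (\<integral>y. 1 / (d + norm (A *v y)) \<partial>?N)"
    using A(2) d lambda_max_pos[OF S]
    by (intro has_bochner_integral_mono[OF has_bochner_integral_gamma_const[OF p d lambda_max_pos[OF S]]])
      (auto intro!: frac_le simp: add_pos_nonneg)
  also have "\<dots> = (\<integral>x. 1 / (d + norm x) \<partial>normal_vec S)"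
    unfolding A(1) by (subst integral_distr) auto
  finally show ?thesis .
qed

lemma integral_radial_component_ge_gamma_const:
  fixes S :: "real^'n^'n"
  assumes p: "CARD('n) \<ge> 2" and S: "pos_def_mat S" and lam: "0 \<le> lam" "lam \<le> lambda_min S"
    and d: "norm \<theta> \<le> d" "0 < d"
  shows "(real CARD('n) - 1) * lam * gamma_const CARD('n) d (lambda_max S)
      \<le> (\<integral>x. x \<bullet> sgn (\<theta> + x) \<partial>normal_vec S)"
proof -
  have "(real CARD('n) - 1) * lam * gamma_const CARD('n) d (lambda_max S)
      \<le> (real CARD('n) - 1) * lambda_min S * (\<integral>x. 1 / (d + norm x) \<partial>normal_vec S)"
    using p lam gamma_const_nonneg[OF p d(2) lambda_max_pos[OF S]]
    by (intro mult_mono gamma_const_lambda_max_le_integral[OF p S d(2)]) auto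
  also have "\<dots> \<le> (\<integral>x. x \<bullet> sgn (\<theta> + x) \<partial>normal_vec S)"
    by (rule integral_radial_component_ge[OF S d])
  finally show ?thesis .
qed

subsection \<open>Normal mixtures\<close>

lemma borel_measurable_det:
  fixes A :: "'a \<Rightarrow> real^'n^'n"
  assumes [measurable]: "\<And>i j. (\<lambda>\<omega>. A \<omega> $ i $ j) \<in> borel_measurable M"
  shows "(\<lambda>\<omega>. det (A \<omega>)) \<in> borel_measurable M"
  unfolding det_def by measurable

lemma matrix_inv_cramer:
  fixes A :: "real^'n^'n"
  assumes "invertible A"
  shows "matrix_inv A $ k $ l = det (\<chi> i j. if j = k then axis l 1 $ i else A $ i $ j) / det A"
proof -
  have "matrix_inv A *v axis l 1 = (\<chi> k. det (\<chi> i j. if j = k then axis l 1 $ i else A $ i $ j) / det A)"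
    using assms by (intro cramer[THEN iffD1] matrix_inv_cancel) (simp add: invertible_det_nz)
  moreover have "(matrix_inv A *v axis l 1) $ k = matrix_inv A $ k $ l"
    by (simp add: matrix_vector_mult_basis column_def)
  ultimately show ?thesis by simp
qed

lemma borel_measurable_matrix_inv:
  fixes D :: "'w \<Rightarrow> real^'n^'n"
  assumes D: "D \<in> borel_measurable M" and invertible: "\<And>\<omega>. \<omega> \<in> space M \<Longrightarrow> invertible (D \<omega>)"
  shows "(\<lambda>\<omega>. matrix_inv (D \<omega>) $ k $ l) \<in> borel_measurable M"
proof -
  note D [measurable]
  have "(\<lambda>\<omega>. det (\<chi> i j. if j = k then axis l 1 $ i else D \<omega> $ i $ j) / det (D \<omega>)) \<in> borel_measurable M"
    by (intro borel_measurable_divide borel_measurable_det) simp_all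
  then show ?thesis by (simp add: matrix_inv_cramer[OF invertible] cong: measurable_cong)
qed

lemma borel_measurable_mvn_density_pair:
  fixes D :: "'w \<Rightarrow> real^'n^'n"
  assumes D: "D \<in> borel_measurable M" and invertible: "\<And>\<omega>. \<omega> \<in> space M \<Longrightarrow> invertible (D \<omega>)"
  shows "(\<lambda>(\<omega>, x). mvn_density (D \<omega>) x) \<in> borel_measurable (M \<Otimes>\<^sub>M borel)"
proof -
  have [measurable]: "(\<lambda>\<omega>. matrix_inv (D \<omega>) $ i $ j) \<in> borel_measurable M" for i j
    by (rule borel_measurable_matrix_inv[OF D invertible])
  have [measurable]: "(\<lambda>\<omega>. det (D \<omega>)) \<in> borel_measurable M"
    by (intro borel_measurable_det borel_measurable_vec_nth D)
  show ?thesis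
    unfolding mvn_density_def inner_vec_def matrix_vector_mult_def by simp
qed

lemma measurable_normal_vec:
  fixes D :: "'w \<Rightarrow> real^'n^'n"
  assumes D: "D \<in> borel_measurable M" and pd: "\<And>\<omega>. \<omega> \<in> space M \<Longrightarrow> pos_def_mat (D \<omega>)"
  shows "(\<lambda>\<omega>. normal_vec (D \<omega>)) \<in> M \<rightarrow>\<^sub>M subprob_algebra borel"
proof (rule measurable_subprob_algebra)
  show "subprob_space (normal_vec (D \<omega>))" if "\<omega> \<in> space M" for \<omega>
    by (intro prob_space_imp_subprob_space prob_space_normal_vec pd that)
  fix B :: "(real^'n) set"
  assume [measurable]: "B \<in> sets borel"
  have [measurable]: "(\<lambda>(\<omega>, x). mvn_density (D \<omega>) x) \<in> borel_measurable (M \<Otimes>\<^sub>M lborel)"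
    using borel_measurable_mvn_density_pair[OF D pos_def_mat_invertible[OF pd]]
    by (simp cong: measurable_cong_sets)
  have "(\<lambda>\<omega>. \<integral>\<^sup>+x. ennreal (mvn_density (D \<omega>) x) * indicator B x \<partial>lborel) \<in> borel_measurable M"
    by measurable
  then show "(\<lambda>\<omega>. emeasure (normal_vec (D \<omega>)) B) \<in> borel_measurable M"
    by (simp add: normal_vec_def emeasure_density)
qed simp

lemma borel_measurable_lambda_max:
  fixes D :: "'w \<Rightarrow> real^'n^'n"
  assumes "D \<in> borel_measurable M" and sym: "\<And>\<omega>. \<omega> \<in> space M \<Longrightarrow> transpose (D \<omega>) = D \<omega>"
  shows "(\<lambda>\<omega>. lambda_max (D \<omega>)) \<in> borel_measurable M"
proof -
  have "D \<in> M \<rightarrow>\<^sub>M restrict_space borel {S. transpose S = S}"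
    using assms by (intro measurable_restrict_space2) auto
  then show ?thesis
    by (rule measurable_compose[OF _ borel_measurable_continuous_on_restrict[OF continuous_on_lambda_max]])
qed

lemma has_bochner_integral_enn2real:
  assumes [measurable]: "u \<in> borel_measurable M" and finite: "(\<integral>\<^sup>+x. u x \<partial>M) \<noteq> \<infinity>"
  shows "has_bochner_integral M (\<lambda>x. enn2real (u x)) (enn2real (\<integral>\<^sup>+x. u x \<partial>M))"
proof (rule has_bochner_integral_nn_integral)
  have "(\<integral>\<^sup>+x. ennreal (enn2real (u x)) \<partial>M) = (\<integral>\<^sup>+x. u x \<partial>M)"
    using nn_integral_PInf_AE[OF assms] by (intro nn_integral_cong_AE) (auto simp: less_top)
  then show "(\<integral>\<^sup>+x. ennreal (enn2real (u x)) \<partial>M) = ennreal (enn2real (\<integral>\<^sup>+x. u x \<partial>M))"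
    using finite by (simp add: less_top)
qed simp_all

lemma has_bochner_integral_bind:
  fixes f :: "'b \<Rightarrow> real"
  assumes K [measurable]: "K \<in> M \<rightarrow>\<^sub>M subprob_algebra N" and [measurable]: "f \<in> borel_measurable N"
    and f: "integrable (M \<bind> K) f"
  shows "has_bochner_integral M (\<lambda>x. \<integral>y. f y \<partial>K x) (\<integral>y. f y \<partial>(M \<bind> K))"
proof -
  define u v where "u x = (\<integral>\<^sup>+y. ennreal (f y) \<partial>K x)" and "v x = (\<integral>\<^sup>+y. ennreal (- f y) \<partial>K x)" for x
  have [measurable]: "u \<in> borel_measurable M" "v \<in> borel_measurable M"
    unfolding u_def v_def by measurable
  have bind: "(\<integral>\<^sup>+y. ennreal (f y) \<partial>(M \<bind> K)) = (\<integral>\<^sup>+x. u x \<partial>M)"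
      "(\<integral>\<^sup>+y. ennreal (- f y) \<partial>(M \<bind> K)) = (\<integral>\<^sup>+x. v x \<partial>M)"
    unfolding u_def v_def by (rule nn_integral_bind[OF _ K]; measurable)+
  then have finite: "(\<integral>\<^sup>+x. u x \<partial>M) \<noteq> \<infinity>" "(\<integral>\<^sup>+x. v x \<partial>M) \<noteq> \<infinity>"
    using f by (auto simp: real_integrable_def)
  have "has_bochner_integral M (\<lambda>x. enn2real (u x) - enn2real (v x))
      (enn2real (\<integral>\<^sup>+x. u x \<partial>M) - enn2real (\<integral>\<^sup>+x. v x \<partial>M))"
    by (intro has_bochner_integral_diff has_bochner_integral_enn2real finite) measurable
  moreover have "enn2real (\<integral>\<^sup>+x. u x \<partial>M) - enn2real (\<integral>\<^sup>+x. v x \<partial>M) = (\<integral>y. f y \<partial>(M \<bind> K))"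
    by (simp add: real_lebesgue_integral_def[OF f] bind)
  moreover have "AE x in M. u x \<noteq> \<infinity>" "AE x in M. v x \<noteq> \<infinity>"
    using finite by (simp_all add: nn_integral_PInf_AE del: infinity_ennreal_def)
  then have "AE x in M. enn2real (u x) - enn2real (v x) = (\<integral>y. f y \<partial>K x)"
    using AE_space
  proof eventually_elim
    case (elim x)
    then have "integrable (K x) f"
      using measurable_cong_sets[OF sets_kernel[OF K elim(3)] refl]
      by (auto simp: real_integrable_def u_def v_def)
    then show ?case by (simp add: real_lebesgue_integral_def u_def v_def)
  qed
  ultimately show ?thesis
    by (subst has_bochner_integral_cong_AE[symmetric, where f="\<lambda>x. enn2real (u x) - enn2real (v x)"])
      auto
qed

locale normal_mixture = prob_space M for M :: "'w measure" +
  fixes \<xi> :: "'w \<Rightarrow> real^'n" and D :: "'w \<Rightarrow> real^'n^'n"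
  assumes measurable_noise [measurable]: "\<xi> \<in> borel_measurable M"
    and measurable_covariance: "D \<in> borel_measurable M"
    and pos_def_covariance: "\<And>\<omega>. \<omega> \<in> space M \<Longrightarrow> pos_def_mat (D \<omega>)"
    and emeasure_noise: "\<And>B. B \<in> sets borel \<Longrightarrow>
      emeasure M (\<xi> -` B \<inter> space M) = (\<integral>\<^sup>+\<omega>. emeasure (normal_vec (D \<omega>)) B \<partial>M)"
begin

lemmas measurable_kernel = measurable_normal_vec[OF measurable_covariance pos_def_covariance]

lemma distr_noise: "distr M borel \<xi> = M \<bind> (\<lambda>\<omega>. normal_vec (D \<omega>))"
proof (rule measure_eqI)
  show "sets (distr M borel \<xi>) = sets (M \<bind> (\<lambda>\<omega>. normal_vec (D \<omega>)))"
    using sets_bind[of M "\<lambda>\<omega>. normal_vec (D \<omega>)" borel] not_empty by simp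
  show "emeasure (distr M borel \<xi>) B = emeasure (M \<bind> (\<lambda>\<omega>. normal_vec (D \<omega>))) B"
    if "B \<in> sets (distr M borel \<xi>)" for B
    using that
    by (simp add: emeasure_distr emeasure_noise emeasure_bind[OF not_empty measurable_kernel])
qed

lemma nn_integral_noise:
  assumes [measurable]: "f \<in> borel_measurable borel"
  shows "(\<integral>\<^sup>+\<omega>. f (\<xi> \<omega>) \<partial>M) = (\<integral>\<^sup>+\<omega>. (\<integral>\<^sup>+x. f x \<partial>normal_vec (D \<omega>)) \<partial>M)"
proof -
  have "(\<integral>\<^sup>+\<omega>. f (\<xi> \<omega>) \<partial>M) = (\<integral>\<^sup>+x. f x \<partial>distr M borel \<xi>)" by (simp add: nn_integral_distr)
  also have "\<dots> = (\<integral>\<^sup>+\<omega>. (\<integral>\<^sup>+x. f x \<partial>normal_vec (D \<omega>)) \<partial>M)"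
    unfolding distr_noise by (rule nn_integral_bind[OF assms measurable_kernel])
  finally show ?thesis .
qed

lemma has_bochner_integral_noise:
  fixes f :: "real^'n \<Rightarrow> real"
  assumes [measurable]: "f \<in> borel_measurable borel" and "integrable M (\<lambda>\<omega>. f (\<xi> \<omega>))"
  shows "has_bochner_integral M (\<lambda>\<omega>. \<integral>x. f x \<partial>normal_vec (D \<omega>)) (\<integral>\<omega>. f (\<xi> \<omega>) \<partial>M)"
  using has_bochner_integral_bind[OF measurable_kernel assms(1)] assms(2)
  by (simp add: distr_noise[symmetric] integral_distr integrable_distr_eq)

lemma measurable_covariance_lambda_max [measurable]: "(\<lambda>\<omega>. lambda_max (D \<omega>)) \<in> borel_measurable M"
  by (intro borel_measurable_lambda_max measurable_covariance pos_def_mat_symmetric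
      pos_def_covariance)

lemma integrable_noise_norm_sq:
  assumes "integrable M (\<lambda>\<omega>. lambda_max (D \<omega>))"
  shows "integrable M (\<lambda>\<omega>. (norm (\<xi> \<omega>))\<^sup>2)"
proof (rule integrableI_nonneg)
  define m where "m = (\<integral>y. (norm y)\<^sup>2 \<partial>normal_vec (mat 1 :: real^'n^'n))"
  have "(\<integral>\<^sup>+\<omega>. ennreal ((norm (\<xi> \<omega>))\<^sup>2) \<partial>M) = (\<integral>\<^sup>+\<omega>. (\<integral>\<^sup>+x. ennreal ((norm x)\<^sup>2) \<partial>normal_vec (D \<omega>)) \<partial>M)"
    by (rule nn_integral_noise) measurable
  also have "\<dots> \<le> (\<integral>\<^sup>+\<omega>. ennreal (lambda_max (D \<omega>) * m) \<partial>M)"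
  proof (intro nn_integral_mono)
    fix \<omega> assume "\<omega> \<in> space M"
    note norm_sq = integral_normal_vec_norm_sq_le[OF pos_def_covariance[OF this]]
    show "(\<integral>\<^sup>+x. ennreal ((norm x)\<^sup>2) \<partial>normal_vec (D \<omega>)) \<le> ennreal (lambda_max (D \<omega>) * m)"
      using norm_sq(2)
      by (subst nn_integral_eq_integral[OF norm_sq(1)]) (auto simp: m_def intro: ennreal_leI)
  qed
  also have "\<dots> < \<infinity>"
    using integrable_mult_left[OF assms, of m] unfolding real_integrable_def by (simp add: less_top)
  finally show "(\<integral>\<^sup>+\<omega>. ennreal ((norm (\<xi> \<omega>))\<^sup>2) \<partial>M) < \<infinity>" .
qed simp_all

lemma integrable_radial_component:
  assumes "integrable M (\<lambda>\<omega>. lambda_max (D \<omega>))"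
  shows "integrable M (\<lambda>\<omega>. \<xi> \<omega> \<bullet> sgn (\<theta> + \<xi> \<omega>))"
proof -
  have "integrable M (\<lambda>\<omega>. norm (\<xi> \<omega>))"
    by (rule square_integrable_imp_integrable[OF _ integrable_noise_norm_sq[OF assms]]) measurable
  then show ?thesis
    by (rule Bochner_Integration.integrable_bound) (simp_all add: abs_inner_le_norm norm_sgn)
qed

lemma expectation_radial_component_ge:
  assumes p: "CARD('n) \<ge> 2" and lam: "0 \<le> lam" "AE \<omega> in M. lam \<le> lambda_min (D \<omega>)"
    and L: "integrable M (\<lambda>\<omega>. lambda_max (D \<omega>))" "expectation (\<lambda>\<omega>. lambda_max (D \<omega>)) \<le> a"
    and d: "norm \<theta> \<le> d" "0 < d"
  shows "(real CARD('n) - 1) * lam * gamma_const CARD('n) d a \<le> expectation (\<lambda>\<omega>. \<xi> \<omega> \<bullet> sgn (\<theta> + \<xi> \<omega>))"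
proof -
  let ?c = "(real CARD('n) - 1) * lam" and ?\<gamma> = "gamma_const CARD('n) d"
  note \<gamma> = gamma_const_le_expectation[OF p d(2) L(1) lambda_max_pos[OF pos_def_covariance] L(2)]
  have "has_bochner_integral M (\<lambda>\<omega>. \<integral>x. x \<bullet> sgn (\<theta> + x) \<partial>normal_vec (D \<omega>))
      (expectation (\<lambda>\<omega>. \<xi> \<omega> \<bullet> sgn (\<theta> + \<xi> \<omega>)))"
    by (intro has_bochner_integral_noise integrable_radial_component L) measurable
  then have radial: "integrable M (\<lambda>\<omega>. \<integral>x. x \<bullet> sgn (\<theta> + x) \<partial>normal_vec (D \<omega>))"
    "expectation (\<lambda>\<omega>. \<integral>x. x \<bullet> sgn (\<theta> + x) \<partial>normal_vec (D \<omega>)) = expectation (\<lambda>\<omega>. \<xi> \<omega> \<bullet> sgn (\<theta> + \<xi> \<omega>))"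
    by (simp_all add: has_bochner_integral_iff)
  have "?c * ?\<gamma> a \<le> ?c * expectation (\<lambda>\<omega>. ?\<gamma> (lambda_max (D \<omega>)))"
    using lam(1) p by (intro mult_left_mono \<gamma>(2)) auto
  also have "\<dots> = expectation (\<lambda>\<omega>. ?c * ?\<gamma> (lambda_max (D \<omega>)))"
    by (rule integral_mult_right_zero[symmetric])
  also have "\<dots> \<le> expectation (\<lambda>\<omega>. \<integral>x. x \<bullet> sgn (\<theta> + x) \<partial>normal_vec (D \<omega>))"
  proof (rule integral_mono_AE[OF integrable_mult_right[OF \<gamma>(1)] radial(1)])
    show "AE \<omega> in M. ?c * ?\<gamma> (lambda_max (D \<omega>)) \<le> (\<integral>x. x \<bullet> sgn (\<theta> + x) \<partial>normal_vec (D \<omega>))"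
      using lam(2) AE_space
      by eventually_elim (intro integral_radial_component_ge_gamma_const p pos_def_covariance lam(1) d)
  qed
  finally show ?thesis by (simp only: radial(2))
qed

end

subsection \<open>Shrinkage towards the origin\<close>

lemma shrinkage_loss_le:
  fixes x \<theta> :: "'a::real_inner"
  shows "(norm ((1 - c / norm (\<theta> + x)) *\<^sub>R (\<theta> + x) - \<theta>))\<^sup>2
    \<le> (norm x)\<^sup>2 - 2 * c * (x \<bullet> sgn (\<theta> + x)) + c\<^sup>2"
proof -
  let ?u = "sgn (\<theta> + x)"
  have "(1 - c / norm (\<theta> + x)) *\<^sub>R (\<theta> + x) - \<theta> = x - c *\<^sub>R ?u"
    by (simp add: sgn_div_norm algebra_simps divide_inverse)
  also have "(norm (x - c *\<^sub>R ?u))\<^sup>2 = (norm x)\<^sup>2 - 2 * c * (x \<bullet> ?u) + c\<^sup>2 * (norm ?u)\<^sup>2"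
    unfolding power2_norm_eq_inner
    by (simp add: inner_diff inner_commute[of ?u x] power2_eq_square algebra_simps)
  also have "c\<^sup>2 * (norm ?u)\<^sup>2 \<le> c\<^sup>2"
    by (simp add: norm_sgn)
  finally show ?thesis by simp
qed

lemma (in normal_mixture) shrinkage_risk_difference_le:
  fixes \<theta> :: "real^'n"
  assumes p: "CARD('n) \<ge> 2" and lam: "0 \<le> lam" "AE \<omega> in M. lam \<le> lambda_min (D \<omega>)"
    and a: "0 < a" "(\<integral>\<^sup>+\<omega>. ennreal (lambda_max (D \<omega>)) \<partial>M) \<le> ennreal a"
    and d: "norm \<theta> \<le> d" "0 < d"
  defines "c \<equiv> (real CARD('n) - 1) * lam * gamma_const CARD('n) d a"
  shows "expectation (\<lambda>\<omega>. (norm ((1 - c / norm (\<theta> + \<xi> \<omega>)) *\<^sub>R (\<theta> + \<xi> \<omega>) - \<theta>))\<^sup>2)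
    - expectation (\<lambda>\<omega>. (norm (\<xi> \<omega>))\<^sup>2) \<le> - c\<^sup>2"
proof -
  let ?h = "\<lambda>\<omega>. \<xi> \<omega> \<bullet> sgn (\<theta> + \<xi> \<omega>)"
  let ?g = "\<lambda>\<omega>. (norm (\<xi> \<omega>))\<^sup>2 - 2 * c * ?h \<omega> + c\<^sup>2"
  have nonneg: "AE \<omega> in M. 0 \<le> lambda_max (D \<omega>)"
    using lambda_max_pos[OF pos_def_covariance] by (auto intro: less_imp_le)
  have L: "integrable M (\<lambda>\<omega>. lambda_max (D \<omega>))"
    using a(2) nonneg by (intro integrableI_nonneg) (auto intro: le_less_trans)
  have "expectation (\<lambda>\<omega>. lambda_max (D \<omega>)) \<le> a"
    using a nn_integral_eq_integral[OF L nonneg] by (simp add: ennreal_le_iff)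
  then have c_le: "c \<le> expectation ?h"
    unfolding c_def by (rule expectation_radial_component_ge[OF p lam L _ d])
  have c_nonneg: "0 \<le> c"
    using p lam(1) gamma_const_nonneg[OF p d(2) a(1)] by (simp add: c_def)
  note int = integrable_noise_norm_sq[OF L] integrable_radial_component[OF L, of \<theta>]
  have "expectation (\<lambda>\<omega>. (norm ((1 - c / norm (\<theta> + \<xi> \<omega>)) *\<^sub>R (\<theta> + \<xi> \<omega>) - \<theta>))\<^sup>2) \<le> expectation ?g"
    using int
    by (intro integral_mono' shrinkage_loss_le order_trans[OF zero_le_power2 shrinkage_loss_le]) auto
  also have "\<dots> = expectation (\<lambda>\<omega>. (norm (\<xi> \<omega>))\<^sup>2) - 2 * c * expectation ?h + c\<^sup>2"
    using int by (simp add: prob_space)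
  also have "\<dots> \<le> expectation (\<lambda>\<omega>. (norm (\<xi> \<omega>))\<^sup>2) - c\<^sup>2"
    using mult_left_mono[OF c_le c_nonneg] by (simp add: power2_eq_square)
  finally show ?thesis by simp
qed

lemma conditionally_normal_imp_normal_mixture:
  fixes \<xi> :: "'w \<Rightarrow> real^'n" and D :: "'w \<Rightarrow> real^'n^'n"
  assumes "prob_space M" and G: "subalgebra M G"
    and "\<xi> \<in> borel_measurable M" "D \<in> borel_measurable G" "\<And>\<omega>. \<omega> \<in> space M \<Longrightarrow> pos_def_mat (D \<omega>)"
    and cond: "\<And>A B. A \<in> sets G \<Longrightarrow> B \<in> sets borel \<Longrightarrow>
      emeasure M (A \<inter> \<xi> -` B \<inter> space M) = (\<integral>\<^sup>+\<omega>\<in>A. emeasure (normal_vec (D \<omega>)) B \<partial>M)"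
  shows "normal_mixture M \<xi> D"
proof (intro normal_mixture.intro normal_mixture_axioms.intro)
  fix B :: "(real^'n) set" assume "B \<in> sets borel"
  moreover have "space G = space M" using G by (simp add: subalgebra_def)
  moreover have "(\<integral>\<^sup>+\<omega>\<in>space M. emeasure (normal_vec (D \<omega>)) B \<partial>M)
      = (\<integral>\<^sup>+\<omega>. emeasure (normal_vec (D \<omega>)) B \<partial>M)"
    by (intro nn_integral_cong) simp
  ultimately show "emeasure M (\<xi> -` B \<inter> space M) = (\<integral>\<^sup>+\<omega>. emeasure (normal_vec (D \<omega>)) B \<partial>M)"
    using cond[OF sets.top, of B] by (simp add: Int_ac)
qed (use assms measurable_from_subalg[OF G] in auto)

theorem theorem2p1:
  fixes \<Theta> :: "(real^'p) set"
    and \<Omega> :: "'w measure" and G :: "'w measure"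
    and P :: "real^'p \<Rightarrow> 'w measure"
    and \<xi> :: "'w \<Rightarrow> real^'p"
    and D :: "'w \<Rightarrow> real^'p^'p"
    and lam astar :: real
  assumes p2: "CARD('p) \<ge> 2"
    and cpt: "compact \<Theta>"
    and dpos: "(SUP \<theta>\<in>\<Theta>. norm \<theta>) > 0"
    and Pprob: "\<And>\<theta>. \<theta> \<in> \<Theta> \<Longrightarrow> prob_space (P \<theta>)"
    and Psets: "\<And>\<theta>. \<theta> \<in> \<Theta> \<Longrightarrow> sets (P \<theta>) = sets \<Omega>"
    and Gsub: "subalgebra \<Omega> G"
    and \<xi>meas: "\<xi> \<in> borel_measurable \<Omega>"
    and Dmeas: "D \<in> borel_measurable G"
    and Dpd: "\<And>\<omega>. \<omega> \<in> space \<Omega> \<Longrightarrow> pos_def_mat (D \<omega>)"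
    and cond_gauss: "\<And>\<theta> A B. \<theta> \<in> \<Theta> \<Longrightarrow> A \<in> sets G \<Longrightarrow> B \<in> sets borel \<Longrightarrow>
        emeasure (P \<theta>) (A \<inter> \<xi> -` B \<inter> space \<Omega>)
          = (\<integral>\<^sup>+\<omega>\<in>A. emeasure (normal_vec (D \<omega>)) B \<partial>P \<theta>)"
    and lam_pos: "lam > 0"
    and hyp_i: "\<And>\<theta>. \<theta> \<in> \<Theta> \<Longrightarrow> AE \<omega> in P \<theta>. lambda_min (D \<omega>) \<ge> lam"
    and astar_pos: "astar > 0"
    and hyp_ii: "\<And>\<theta>. \<theta> \<in> \<Theta> \<Longrightarrow> (\<integral>\<^sup>+\<omega>. ennreal (lambda_max (D \<omega>)) \<partial>P \<theta>) \<le> ennreal astar"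
  shows "\<forall>\<theta>\<in>\<Theta>.
     (let Y = (\<lambda>\<omega>. \<theta> + \<xi> \<omega>);
          c = (real CARD('p) - 1) * lam * gamma_const CARD('p) (SUP \<theta>\<in>\<Theta>. norm \<theta>) astar;
          \<theta>star = (\<lambda>\<omega>. (1 - c / norm (Y \<omega>)) *\<^sub>R Y \<omega>)
      in (\<integral>\<omega>. (norm (\<theta>star \<omega> - \<theta>))\<^sup>2 \<partial>P \<theta>) - (\<integral>\<omega>. (norm (Y \<omega> - \<theta>))\<^sup>2 \<partial>P \<theta>) \<le> - c\<^sup>2)"
proof (rule ballI, goal_cases)
  case \<theta>: (1 \<theta>)
  have P: "space (P \<theta>) = space \<Omega>" "measurable (P \<theta>) = measurable \<Omega>"
    using sets_eq_imp_space_eq[OF Psets[OF \<theta>]] measurable_cong_sets[OF Psets[OF \<theta>] refl] by auto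
  interpret normal_mixture "P \<theta>" \<xi> D
  proof (rule conditionally_normal_imp_normal_mixture)
    show "subalgebra (P \<theta>) G" using Gsub Psets[OF \<theta>] by (simp add: subalgebra_def P(1))
  qed (use Pprob \<xi>meas Dmeas Dpd cond_gauss \<theta> in \<open>simp_all add: P\<close>)
  have "bdd_above (norm ` \<Theta>)"
    using compact_imp_bounded[OF cpt] by (simp add: bounded_imp_bdd_above bounded_norm_comp)
  then have "norm \<theta> \<le> (SUP \<theta>\<in>\<Theta>. norm \<theta>)" by (rule cSUP_upper[OF \<theta>])
  with shrinkage_risk_difference_le[OF p2 _ hyp_i[OF \<theta>] astar_pos hyp_ii[OF \<theta>] _ dpos] lam_pos
  show ?case by (simp add: Let_def)
qed

end
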